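(* Let $N\ge 1$, let $x$ be a complex parameter, and let $R\in SO(2N+1)$ be a real special orthogonal matrix. Then $$\exp(x\,\mathrm{Tr}\,R)=e^{x}\sum_{n_1\ge n_2\ge\cdots\ge n_N\ge 0}\det\left[I_{n_j+i-j}(2x)-I_{n_j+2N+1-i-j}(2x)\right]\chi_{(n_1,\dots,n_N)}(R),$$ where the determinant is of the $N\times N$ matrix with the displayed entry in row $i$ and column $j$.
   Context: $I_\lambda$ is the modified Bessel function: for integers $\lambda\ge 0$, $I_\lambda(x)=\sum_{p=0}^{\infty}\frac{1}{p!(p+\lambda)!}\left(\frac{x}{2}\right)^{2p+\lambda}$, and $I_{-\lambda}=I_\lambda$. The eigenvalues of $R$ are $t_1,\dots,t_N,t_1^{-1},\dots,t_N^{-1},1$ with $|t_i|=1$. For integers $n_1\ge\cdots\ge n_N\ge 0$, $\chi_{(n_1,\dots,n_N)}$ is the irreducible (non-spinor) character of $SO(2N+1)$ given by the Weyl formula $$\chi_{(n_1,\dots,n_N)}(R)=\frac{\det\left[t_i^{n_j+N-j+\frac12}-t_i^{-(n_j+N-j+\frac12)}\right]}{\det\left[t_i^{N+\frac12-j}-t_i^{-(N+\frac12-j)}\right]}$$ ($N\times N$ determinants, row $i$, column $j$; for each $i$ the same square root $t_i^{1/2}$ is used in numerator and denominator; the ratio is a Laurent polynomial in the $t_i$, and is interpreted as such where the denominator vanishes). The sum runs over all integer tuples $n_1\ge\cdots\ge n_N\ge 0$. *)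

theory Defs
  imports
    "HOL-Analysis.Infinite_Sum"
    "HOL-Library.Poly_Mapping"
    "Jordan_Normal_Form.Char_Poly"
begin

text \<open>
  Matrix rows and columns, the parameters \<open>t\<close>, and the entries of the tuple \<open>n\<close> are all indexed
  from 0: the mathematical indices \<open>i, j \<in> {1..N}\<close> correspond to \<open>i + 1, j + 1\<close> below.
\<close>

definition bessel_I :: "int \<Rightarrow> complex \<Rightarrow> complex" where
  "bessel_I l x =
     suminf (\<lambda>p. 1 / (fact p * fact (p + nat \<bar>l\<bar>)) * (x / 2) ^ (2 * p + nat \<bar>l\<bar>))"

definition bessel_det :: "nat \<Rightarrow> nat list \<Rightarrow> complex \<Rightarrow> complex" where
  "bessel_det N n y =
     det (mat N N (\<lambda>(i, j).
       bessel_I (int (n ! j) + int (i + 1) - int (j + 1)) y -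
       bessel_I (int (n ! j) + 2 * int N + 1 - int (i + 1) - int (j + 1)) y))"

definition trace :: "'a :: comm_monoid_add mat \<Rightarrow> 'a" where
  "trace A = (\<Sum>i<dim_row A. A $$ (i, i))"

definition special_orthogonal :: "nat \<Rightarrow> real mat set" where
  "special_orthogonal m =
     {R \<in> carrier_mat m m. transpose_mat R * R = 1\<^sub>m m \<and> det R = 1}"

text \<open>Tuples \<open>n\<^sub>1 \<ge> \<dots> \<ge> n\<^sub>N \<ge> 0\<close>.\<close>

definition dominant_weights :: "nat \<Rightarrow> nat list set" where
  "dominant_weights N = {n. length n = N \<and> sorted_wrt (\<ge>) n}"

text \<open>
  Laurent polynomials are finitely supported coefficient functions on exponent vectors.
\<close>

type_synonym laurent = "(nat \<Rightarrow>\<^sub>0 int) \<Rightarrow>\<^sub>0 complex"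

definition laurent_in_vars :: "nat \<Rightarrow> laurent \<Rightarrow> bool" where
  "laurent_in_vars N p \<longleftrightarrow> (\<forall>e\<in>Poly_Mapping.keys p. Poly_Mapping.keys e \<subseteq> {..<N})"

definition laurent_eval :: "laurent \<Rightarrow> (nat \<Rightarrow> complex) \<Rightarrow> complex" where
  "laurent_eval p t =
     (\<Sum>e\<in>Poly_Mapping.keys p. Poly_Mapping.lookup p e *
        (\<Prod>i\<in>Poly_Mapping.keys e. t i powi Poly_Mapping.lookup e i))"

text \<open>
  The determinants of the Weyl formula contain half-integral powers of the \<open>t\<^sub>i\<close>. They are
  written as functions of the square roots \<open>s\<^sub>i = t\<^sub>i\<^sup>1\<^sup>/\<^sup>2\<close>, so all exponents are doubled.
  The denominator is the alternant of the zero tuple.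
\<close>

definition weyl_alternant :: "nat \<Rightarrow> nat list \<Rightarrow> (nat \<Rightarrow> complex) \<Rightarrow> complex" where
  "weyl_alternant N n s =
     det (mat N N (\<lambda>(i, j).
       let a = 2 * (int (n ! j) + int N - int (j + 1)) + 1
       in s i powi a - s i powi (- a)))"

definition weyl_character :: "nat \<Rightarrow> nat list \<Rightarrow> laurent" where
  "weyl_character N n =
     (THE p. laurent_in_vars N p \<and>
        (\<forall>s. (\<forall>i<N. s i \<noteq> 0) \<and> weyl_alternant N (replicate N 0) s \<noteq> 0 \<longrightarrow>
          laurent_eval p (\<lambda>i. (s i)\<^sup>2) =
            weyl_alternant N n s / weyl_alternant N (replicate N 0) s))"

text \<open>
  The eigenvalues of \<open>R\<close>, with multiplicity, are \<open>t\<^sub>i\<close>, \<open>t\<^sub>i\<^sup>-\<^sup>1\<close> for \<open>i < N\<close>, and \<open>1\<close>.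
\<close>

definition eigen_params :: "nat \<Rightarrow> real mat \<Rightarrow> (nat \<Rightarrow> complex) \<Rightarrow> bool" where
  "eigen_params N R t \<longleftrightarrow>
     (\<forall>i<N. cmod (t i) = 1) \<and>
     char_poly (map_mat complex_of_real R) =
       [:- 1, 1:] * (\<Prod>i<N. [:- t i, 1:] * [:- inverse (t i), 1:])"

text \<open>
  The parameters \<open>t\<close> are determined by \<open>R\<close> up to permutations and inversions \<open>t\<^sub>i \<mapsto> t\<^sub>i\<^sup>-\<^sup>1\<close>,
  under which the character is invariant; the choice made by \<open>SOME\<close> is therefore immaterial.
\<close>

definition so_character :: "nat \<Rightarrow> nat list \<Rightarrow> real mat \<Rightarrow> complex" where
  "so_character N n R = laurent_eval (weyl_character N n) (SOME t. eigen_params N R t)"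

end

theory Submission
  imports "HOL-Analysis.Uniform_Limit" "Jordan_Normal_Form.Schur_Decomposition" Defs
begin

text \<open>
  Put \<open>w\<^sub>i = t\<^sub>i + t\<^sub>i\<^sup>-\<^sup>1\<close>. Each entry \<open>t\<^sub>i\<^sup>a - t\<^sub>i\<^sup>-\<^sup>a\<close> of a Weyl alternant is
  \<open>t\<^sub>i\<^sup>1\<^sup>/\<^sup>2 - t\<^sub>i\<^sup>-\<^sup>1\<^sup>/\<^sup>2\<close> times a monic polynomial in \<open>w\<^sub>i\<close>, so by Newton interpolation the
  character is the determinant of the divided differences of these polynomials at \<open>w\<^sub>1, \<dots>, w\<^sub>N\<close>. This
  makes sense also where the Weyl denominator vanishes.
  The generating function of the Bessel functions expands \<open>exp (x w)\<close> times such a polynomial in the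
  same polynomials, with coefficients that are differences of two Bessel functions. Taking divided
  differences and applying the Cauchy-Binet formula with an infinite summation index gives the sum
  over all weights on one side. On the other side stands a determinant which equals the product of
  the \<open>exp (x w\<^sub>i)\<close>: for distinct \<open>w\<^sub>i\<close> by undoing the Newton interpolation, in general by continuity.
\<close>

section \<open>Cauchy-Binet with an infinite summation index\<close>

lemma det_mat_eq:
  "det (mat n n f) = (\<Sum>p | p permutes {0..<n}. signof p * (\<Prod>i = 0..<n. f (i, p i)))"
proof -
  have "(\<Prod>i = 0..<n. mat n n f $$ (i, p i)) = (\<Prod>i = 0..<n. f (i, p i))"
    if "p permutes {0..<n}" for p
    using permutes_in_image[OF that] by (intro prod.cong) auto
  then show ?thesis
    by (simp add: det_def'[of _ n])
qed

text \<open>Adding one coordinate turns the index set into a product of two sets and the function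
  into a product of functions of separate variables. This supplies the summability needed to
  multiply out a product of series.\<close>

lemma abs_summable_on_prod_PiE:
  fixes f :: "'a \<Rightarrow> 'b \<Rightarrow> complex"
  assumes "finite A" and "\<And>x. x \<in> A \<Longrightarrow> f x abs_summable_on B x"
  shows "(\<lambda>g. \<Prod>x\<in>A. f x (g x)) abs_summable_on PiE A B"
  using assms
proof (induction A rule: finite_induct)
  case empty
  then show ?case by simp
next
  case (insert x A)
  have IH: "(\<lambda>g. \<Prod>x\<in>A. f x (g x)) abs_summable_on PiE A B"
    using insert by auto
  have "(\<lambda>(y, g). f x y * (\<Prod>x\<in>A. f x (g x))) abs_summable_on B x \<times> PiE A B"
    unfolding abs_summable_on_Sigma_iff
    using IH summable_on_cmult_left[OF insert.prems[of x]]
    by (auto simp: norm_mult infsum_cmult_right' infsum_nonneg intro!: summable_on_cmult_right)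
  also have "?this \<longleftrightarrow> (\<lambda>h. \<Prod>x\<in>insert x A. f x (h x)) abs_summable_on
      (\<lambda>(y, g). g(x := y)) ` (B x \<times> PiE A B)"
  proof (subst summable_on_reindex)
    show "inj_on (\<lambda>(y, g). g(x := y)) (B x \<times> PiE A B)"
      using insert.hyps by (intro inj_combinator)
    have "(\<Prod>z\<in>insert x A. f z ((g(x := y)) z)) = f x y * (\<Prod>z\<in>A. f z (g z))" for y g
      using insert.hyps by (auto intro!: prod.cong)
    then show "(\<lambda>(y, g). f x y * (\<Prod>x\<in>A. f x (g x))) abs_summable_on B x \<times> PiE A B \<longleftrightarrow>
      (\<lambda>h. norm (\<Prod>x\<in>insert x A. f x (h x))) \<circ> (\<lambda>(y, g). g(x := y)) summable_on B x \<times> PiE A B"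
      by (intro summable_on_cong) (auto simp: case_prod_unfold)
  qed
  finally show ?case
    by (simp add: PiE_insert_eq)
qed

text \<open>Every \<open>N\<close>-element subset of the index type occurs exactly once, as its
  decreasing enumeration. Fixing the values outside \<open>{0..<N}\<close> makes the representing
  function unique.\<close>

definition decreasing_tuples :: "nat \<Rightarrow> (nat \<Rightarrow> 'k :: linorder) set" where
  "decreasing_tuples N = {f \<in> {0..<N} \<rightarrow>\<^sub>E UNIV. \<forall>i j. i < j \<longrightarrow> j < N \<longrightarrow> f j < f i}"

lemma decreasing_tuples_sorted:
  assumes "f \<in> decreasing_tuples N"
  shows "sorted (rev (map f [0..<N]))" "distinct (rev (map f [0..<N]))" "inj_on f {0..<N}"
proof -
  have lt: "f j < f i" if "i < j" "j < N" for i j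
    using assms that by (auto simp: decreasing_tuples_def)
  have "sorted_wrt (<) (rev (map f [0..<N]))"
    unfolding sorted_wrt_rev unfolding sorted_wrt_iff_nth_less by (auto intro: lt)
  then show "sorted (rev (map f [0..<N]))" "distinct (rev (map f [0..<N]))"
    by (simp_all only: strict_sorted_iff)
  then show "inj_on f {0..<N}"
    by (simp add: distinct_map)
qed

text \<open>Sorting an injective tuple gives its decreasing part \<open>k\<close>, determined by the
  set of values; injectivity of \<open>k\<close> then determines the permutation.\<close>

lemma bij_betw_decreasing_tuples_permutations:
  "bij_betw (\<lambda>(k, p). k \<circ> p) (decreasing_tuples N \<times> {p. p permutes {0..<N}})
     {f \<in> {0..<N} \<rightarrow>\<^sub>E (UNIV :: 'k :: linorder set). inj_on f {0..<N}}"
  (is "bij_betw ?c (?K \<times> ?S) ?F")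
proof (rule bij_betw_imageI)
  show "inj_on ?c (?K \<times> ?S)"
  proof (rule inj_onI, clarsimp)
    fix k k' :: "nat \<Rightarrow> 'k" and p p'
    assume k: "k \<in> ?K" "k' \<in> ?K" and p: "p permutes {0..<N}" "p' permutes {0..<N}"
      and eq: "k \<circ> p = k' \<circ> p'"
    have "k ` {0..<N} = k' ` {0..<N}"
      using arg_cong[OF eq, of "\<lambda>h. h ` {0..<N}"] p unfolding image_comp[symmetric]
      by (simp add: permutes_image)
    then have "rev (map k [0..<N]) = rev (map k' [0..<N])"
      by (intro sorted_distinct_set_unique) (use k decreasing_tuples_sorted in \<open>simp_all\<close>)
    then have *: "k i = k' i" if "i \<in> {0..<N}" for i
      using that by simp
    have "k = k'"
      by (rule PiE_ext[of k "{0..<N}" "\<lambda>_. UNIV" k'])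
        (use k * in \<open>auto simp: decreasing_tuples_def\<close>)
    moreover have "p i = p' i" for i
    proof (cases "i < N")
      case True
      then show ?thesis
        using fun_cong[OF eq, of i] \<open>k = k'\<close> decreasing_tuples_sorted(3)[OF k(1)]
          permutes_in_image[OF p(1), of i] permutes_in_image[OF p(2), of i]
        by (auto dest: inj_onD)
    next
      case False
      then show ?thesis
        using p by (simp add: permutes_not_in)
    qed
    ultimately show "k = k' \<and> p = p'"
      by auto
  qed
  show "?c ` (?K \<times> ?S) = ?F"
  proof (intro equalityI subsetI)
    fix f assume "f \<in> ?c ` (?K \<times> ?S)"
    then obtain k p where f: "f = k \<circ> p" and k: "k \<in> ?K" and p: "p permutes {0..<N}"
      by auto
    have "inj_on f {0..<N}"
      unfolding f using p decreasing_tuples_sorted(3)[OF k]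
      by (intro comp_inj_on) (auto simp: permutes_image permutes_inj_on)
    moreover have "f \<in> {0..<N} \<rightarrow>\<^sub>E UNIV"
      using k by (auto simp: f decreasing_tuples_def PiE_def extensional_def permutes_not_in[OF p])
    ultimately show "f \<in> ?F" by simp
  next
    fix f :: "nat \<Rightarrow> 'k" assume f: "f \<in> ?F"
    define xs where "xs = rev (sort (map f [0..<N]))"
    define k where "k i = (if i < N then xs ! i else undefined)" for i
    have len: "length xs = N" by (simp add: xs_def)
    have "distinct xs" using f by (simp add: xs_def distinct_map)
    then have "sorted_wrt (<) (rev xs)"
      by (simp add: strict_sorted_iff xs_def)
    then have dec: "xs ! j < xs ! i" if "i < j" "j < N" for i j
      using that len unfolding sorted_wrt_rev unfolding sorted_wrt_iff_nth_less by auto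
    then have k: "k \<in> ?K"
      by (auto simp: decreasing_tuples_def k_def)
    \<comment> \<open>Sorting preserves the multiset of values, and two enumerations of one multiset
      differ by a permutation of the positions.\<close>
    have "image_mset f (mset_set {0..<N}) = mset (map f [0..<N])"
      by simp
    also have "\<dots> = mset xs"
      by (simp add: xs_def)
    also have "xs = map k [0..<N]"
      by (rule nth_equalityI) (auto simp: len k_def)
    also have "mset \<dots> = image_mset k (mset_set {0..<N})"
      by simp
    finally obtain p where p: "p permutes {0..<N}" "\<forall>x\<in>{0..<N}. f x = k (p x)"
      using image_mset_eq_implies_permutes[of "{0..<N}" f k] by auto
    have "f = k \<circ> p"
    proof
      fix i show "f i = (k \<circ> p) i"
        using f p by (cases "i < N") (auto simp: permutes_not_in k_def PiE_def extensional_def)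
    qed
    then show "f \<in> ?c ` (?K \<times> ?S)"
      using k p(1) by force
  qed
qed

lemma has_sum_sum:
  fixes f :: "'i \<Rightarrow> 'a \<Rightarrow> 'b :: topological_comm_monoid_add"
  assumes "finite I" and "\<And>i. i \<in> I \<Longrightarrow> (f i has_sum s i) A"
  shows "((\<lambda>x. \<Sum>i\<in>I. f i x) has_sum (\<Sum>i\<in>I. s i)) A"
  using assms by (induction I rule: finite_induct) (auto intro: has_sum_add)

text \<open>Multiplying out the Leibniz formula of the determinant of sums gives a sum over all
  index tuples \<open>f\<close>. Tuples with a repetition contribute 0. The others are
  \<open>k \<circ> p\<close> with \<open>k\<close> decreasing, and summing over \<open>p\<close> for
  fixed \<open>k\<close> rebuilds the determinant in \<open>Q\<close>.\<close>

lemma cauchy_binet_has_sum: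
  fixes Q :: "nat \<Rightarrow> 'k :: linorder \<Rightarrow> complex"
  assumes summable: "\<And>i j. i < N \<Longrightarrow> j < N \<Longrightarrow> (\<lambda>k. Q i k * B k j) summable_on UNIV"
  shows "((\<lambda>k. det (mat N N (\<lambda>(i, j). Q i (k j))) * det (mat N N (\<lambda>(i, j). B (k i) j)))
           has_sum det (mat N N (\<lambda>(i, j). \<Sum>\<^sub>\<infinity>k. Q i k * B k j))) (decreasing_tuples N)"
proof -
  define F where "F = ({0..<N} \<rightarrow>\<^sub>E (UNIV :: 'k set))"
  define S where "S = {p. p permutes {0..<N}}"
  define h where "h f = (\<Prod>i = 0..<N. Q i (f i)) * det (mat N N (\<lambda>(i, j). B (f i) j))" for f
  have finS: "finite S"
    by (simp add: S_def finite_permutations)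
  have lt: "p i < N" if "p \<in> S" "i < N" for p i
    using that permutes_in_image[of p "{0..<N}" i] by (simp add: S_def)
  have "((\<lambda>f. signof p * (\<Prod>i = 0..<N. Q i (f i) * B (f i) (p i))) has_sum
     signof p * (\<Prod>i = 0..<N. \<Sum>\<^sub>\<infinity>k. Q i k * B k (p i))) F" if "p \<in> S" for p
  proof -
    have abs: "(\<lambda>k. Q i k * B k (p i)) abs_summable_on UNIV" if "i \<in> {0..<N}" for i
      using summable[of i "p i"] lt[of p i] that \<open>p \<in> S\<close>
      by (simp add: summable_on_iff_abs_summable_on_complex)
    show ?thesis
      unfolding F_def has_sum_iff
      using infsum_prod_PiE_abs[OF finite_atLeastLessThan abs]
        abs_summable_summable[OF abs_summable_on_prod_PiE[OF finite_atLeastLessThan abs]]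
      by (auto simp: infsum_cmult_right' intro: summable_on_cmult_right)
  qed
  then have "((\<lambda>f. \<Sum>p\<in>S. signof p * (\<Prod>i = 0..<N. Q i (f i) * B (f i) (p i))) has_sum
      det (mat N N (\<lambda>(i, j). \<Sum>\<^sub>\<infinity>k. Q i k * B k j))) F"
    unfolding det_mat_eq S_def[symmetric] by (intro has_sum_sum finS) simp
  also have "(\<lambda>f. \<Sum>p\<in>S. signof p * (\<Prod>i = 0..<N. Q i (f i) * B (f i) (p i))) = h"
    by (simp add: h_def det_mat_eq S_def prod.distrib sum_distrib_left mult_ac fun_eq_iff)
  finally have "(h has_sum det (mat N N (\<lambda>(i, j). \<Sum>\<^sub>\<infinity>k. Q i k * B k j))) F" .
  also have "?this \<longleftrightarrow> (h has_sum det (mat N N (\<lambda>(i, j). \<Sum>\<^sub>\<infinity>k. Q i k * B k j))) {f \<in> F. inj_on f {0..<N}}"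
  proof (rule has_sum_cong_neutral)
    fix f assume "f \<in> F - {f \<in> F. inj_on f {0..<N}}"
    then obtain i j where "i < N" "j < N" "i \<noteq> j" "f i = f j"
      by (auto simp: inj_on_def)
    then have "det (mat N N (\<lambda>(i, j). B (f i) j)) = 0"
      by (intro det_identical_rows[of _ N i j]) auto
    then show "h f = 0" by (simp add: h_def)
  qed auto
  also have "\<dots> \<longleftrightarrow> ((\<lambda>x. h (case x of (k, p) \<Rightarrow> k \<circ> p)) has_sum
      det (mat N N (\<lambda>(i, j). \<Sum>\<^sub>\<infinity>k. Q i k * B k j))) (decreasing_tuples N \<times> S)"
    unfolding F_def S_def
    by (rule has_sum_reindex_bij_betw[OF bij_betw_decreasing_tuples_permutations, symmetric])
  finally show ?thesis
  proof (rule has_sum_SigmaD)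
    fix k :: "nat \<Rightarrow> 'k"
    \<comment> \<open>Permuting the rows of the second matrix produces the sign that the Leibniz
      formula for the first one requires.\<close>
    have "h (k \<circ> p) = signof p * (\<Prod>i = 0..<N. Q i (k (p i))) * det (mat N N (\<lambda>(i, j). B (k i) j))"
      if "p \<in> S" for p
    proof -
      have "mat N N (\<lambda>(i, j). B ((k \<circ> p) i) j) =
          mat N N (\<lambda>(i, j). mat N N (\<lambda>(i, j). B (k i) j) $$ (p i, j))"
        using lt[OF that] by (intro eq_matI) auto
      then show ?thesis
        using that det_permute_rows[of "mat N N (\<lambda>(i, j). B (k i) j)" N p] by (simp add: h_def S_def)
    qed
    then have "(\<Sum>p\<in>S. h (k \<circ> p)) =
        det (mat N N (\<lambda>(i, j). Q i (k j))) * det (mat N N (\<lambda>(i, j). B (k i) j))"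
      by (simp add: det_mat_eq[of _ "\<lambda>(i, j). Q i (k j)"] S_def sum_distrib_right)
    then show "((\<lambda>p. h (case (k, p) of (k, p) \<Rightarrow> k \<circ> p)) has_sum
        det (mat N N (\<lambda>(i, j). Q i (k j))) * det (mat N N (\<lambda>(i, j). B (k i) j))) S"
      using finS by (intro has_sum_finiteI) auto
  qed
qed

section \<open>Bessel functions and Chebyshev polynomials\<close>

lemma exp_has_sum: "((\<lambda>n. z ^ n / fact n) has_sum exp z) UNIV" for z :: complex
proof (rule norm_summable_imp_has_sum)
  show "summable (\<lambda>n. norm (z ^ n / fact n))"
    using summable_norm_exp[of z] by (simp add: scaleR_conv_of_real field_simps)
  show "(\<lambda>n. z ^ n / fact n) sums exp z"
    using exp_converges[of z] by (simp add: scaleR_conv_of_real field_simps)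
qed

lemma has_sum_product:
  fixes f :: "'a \<Rightarrow> complex" and g :: "'b \<Rightarrow> complex"
  assumes f: "(f has_sum a) A" and g: "(g has_sum b) B"
  shows "((\<lambda>(x, y). f x * g y) has_sum a * b) (A \<times> B)"
proof (rule has_sum_SigmaI)
  show "((\<lambda>y. case (x, y) of (x, y) \<Rightarrow> f x * g y) has_sum f x * b) B" for x
    using has_sum_cmult_right[OF g, of "f x"] by simp
  show "((\<lambda>x. f x * b) has_sum a * b) A"
    using has_sum_cmult_left[OF f] by simp
  have "f abs_summable_on A" "g abs_summable_on B"
    using f g by (auto simp flip: summable_on_iff_abs_summable_on_complex simp: has_sum_imp_summable)
  then have "(\<lambda>(x, y). f x * g y) abs_summable_on A \<times> B"
    unfolding abs_summable_on_Sigma_iff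
    by (auto simp: norm_mult infsum_cmult_right' infsum_nonneg
        intro!: summable_on_cmult_right summable_on_cmult_left)
  then show "(\<lambda>(x, y). f x * g y) summable_on A \<times> B"
    by (rule abs_summable_summable)
qed

text \<open>The product of the series of \<open>exp (x * t)\<close> and \<open>exp (x / t)\<close>, summed along the
  lines \<open>p - q = d\<close>.\<close>
lemma bessel_I_generating_function:
  assumes t: "t \<noteq> 0"
  shows "((\<lambda>d. bessel_I d (2 * x) * t powi d) has_sum exp (x * (t + inverse t))) UNIV"
proof -
  define f where "f = (\<lambda>(p, q). ((x * t) ^ p / fact p) * ((x * inverse t) ^ q / fact q))"
  \<comment> \<open>\<open>m\<close> is the smaller of the two exponents and \<open>d\<close> their
    difference; at most one of \<open>nat d\<close> and \<open>nat (- d)\<close> is nonzero.\<close>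
  define g where "g = (\<lambda>(d, m). (m + nat d, m + nat (- d)))"
  have "(f has_sum exp (x * t) * exp (x * inverse t)) (UNIV \<times> UNIV)"
    unfolding f_def by (intro has_sum_product exp_has_sum)
  also have "exp (x * t) * exp (x * inverse t) = exp (x * (t + inverse t))"
    by (simp add: ring_distribs flip: exp_add)
  also have "(f has_sum exp (x * (t + inverse t))) (UNIV \<times> UNIV) \<longleftrightarrow>
      ((\<lambda>y. f (g y)) has_sum exp (x * (t + inverse t))) (UNIV \<times> UNIV)"
  proof (rule has_sum_reindex_bij_witness[where i = g and j = "\<lambda>(p, q). (int p - int q, min p q)"])
    show g_inv: "g (case y of (p, q) \<Rightarrow> (int p - int q, min p q)) = y" for y
      by (auto simp: g_def min_def split: prod.splits)
    show "f (g (case y of (p, q) \<Rightarrow> (int p - int q, min p q))) = f y" for y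
      by (simp only: g_inv)
  qed (auto simp: g_def)
  finally have fg: "((\<lambda>y. f (g y)) has_sum exp (x * (t + inverse t))) (UNIV \<times> UNIV)" .
  then show ?thesis
  proof (rule has_sum_SigmaD)
    fix d :: int
    have eq: "f (g (d, m)) = 1 / (fact m * fact (m + nat \<bar>d\<bar>)) * (2 * x / 2) ^ (2 * m + nat \<bar>d\<bar>) * t powi d" for m
    proof -
      have "(x * t) ^ (m + nat d) * (x * inverse t) ^ (m + nat (- d)) = x ^ (2 * m + nat \<bar>d\<bar>) * t powi d"
      proof (cases "d \<ge> 0")
        case True
        then show ?thesis
          using t by (simp add: power_int_def power_mult_distrib power_add mult_2_right field_simps)
      next
        case False
        then show ?thesis
          using t by (simp add: power_int_def power_mult_distrib power_add mult_2_right field_simps)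
      qed
      then show ?thesis
        by (cases "d \<ge> 0") (simp_all add: f_def g_def field_simps)
    qed
    have "(\<lambda>m. f (g (d, m))) summable_on UNIV"
      by (rule summable_on_SigmaD1[of "\<lambda>d m. f (g (d, m))" UNIV "\<lambda>_. UNIV"])
        (use has_sum_imp_summable[OF fg] in \<open>simp_all add: case_prod_unfold\<close>)
    \<comment> \<open>After division by \<open>t powi d\<close> the inner series is literally the
      one in \<open>bessel_I_def\<close>.\<close>
    then have "((\<lambda>m. f (g (d, m)) / t powi d) has_sum (\<Sum>\<^sub>\<infinity>m. f (g (d, m))) / t powi d) UNIV"
      by (intro has_sum_divide_const) simp
    moreover from has_sum_imp_sums[OF this] have "bessel_I d (2 * x) = (\<Sum>\<^sub>\<infinity>m. f (g (d, m))) / t powi d"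
      using t unfolding bessel_I_def eq by (simp add: sums_iff)
    ultimately show "((\<lambda>m. f (g (d, m))) has_sum bessel_I d (2 * x) * t powi d) UNIV"
      using t \<open>(\<lambda>m. f (g (d, m))) summable_on UNIV\<close> by simp
  qed
qed

lemma bessel_I_minus: "bessel_I (- d) y = bessel_I d y"
  by (simp add: bessel_I_def)

text \<open>The coefficient of \<open>cheb k w\<close> in the expansion of
  \<open>exp (x * w) * cheb b w\<close>. With \<open>k\<close> a shifted weight and
  \<open>b = N - 1 - i\<close> it is an entry in row \<open>i\<close> of
  \<open>bessel_det\<close>.\<close>

definition bessel_kernel :: "complex \<Rightarrow> nat \<Rightarrow> nat \<Rightarrow> complex" where
  "bessel_kernel x k b = bessel_I (int k - int b) (2 * x) - bessel_I (int k + int b + 1) (2 * x)"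

text \<open>The generating function converges absolutely at \<open>t = C\<close>; restricting it to
  indices \<open>k + l\<close> changes the powers of \<open>C\<close> only by a constant factor.
  Hence Bessel functions outweigh any geometric growth in \<open>k\<close>.\<close>

lemma bessel_I_summable_shift:
  fixes C :: real
  assumes "C > 0"
  shows "(\<lambda>k. norm (bessel_I (int k + l) (2 * x)) * C ^ k) summable_on UNIV"
proof -
  have "(\<lambda>d. bessel_I d (2 * x) * of_real C powi d) summable_on UNIV"
    using bessel_I_generating_function[of "of_real C" x] assms by (auto simp: has_sum_imp_summable)
  then have "(\<lambda>d. norm (bessel_I d (2 * x) * of_real C powi d)) summable_on range (\<lambda>k. int k + l)"
    unfolding summable_on_iff_abs_summable_on_complex by (rule summable_on_subset_banach) simp
  then have "(\<lambda>k. norm (bessel_I (int k + l) (2 * x) * of_real C powi (int k + l))) summable_on UNIV"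
    by (subst (asm) summable_on_reindex) (auto simp: inj_on_def o_def)
  then have "(\<lambda>k. norm (bessel_I (int k + l) (2 * x) * of_real C powi (int k + l)) * C powi (- l)) summable_on UNIV"
    by (rule summable_on_cmult_left)
  then show ?thesis
    using assms by (simp add: norm_mult norm_power norm_power_int power_int_add power_int_minus mult.assoc)
qed

lemma bessel_kernel_summable:
  fixes C :: real
  assumes "C > 0"
  shows "(\<lambda>k. norm (bessel_kernel x k b) * C ^ k) summable_on UNIV"
proof (rule summable_on_comparison_test)
  show "(\<lambda>k. norm (bessel_I (int k + (- int b)) (2 * x)) * C ^ k +
      norm (bessel_I (int k + (int b + 1)) (2 * x)) * C ^ k) summable_on UNIV"
    by (intro summable_on_add bessel_I_summable_shift assms)
  show "norm (bessel_kernel x k b) * C ^ k \<le> norm (bessel_I (int k + (- int b)) (2 * x)) * C ^ k +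
      norm (bessel_I (int k + (int b + 1)) (2 * x)) * C ^ k" for k
    unfolding distrib_right[symmetric]
    using norm_triangle_ineq4[of "bessel_I (int k - int b) (2 * x)" "bessel_I (int k + int b + 1) (2 * x)"] assms
    by (intro mult_right_mono) (simp_all add: bessel_kernel_def add.assoc)
qed (use assms in auto)

section \<open>Expansion of exponentials in Chebyshev polynomials\<close>

text \<open>Chebyshev polynomials of the fourth kind, normalised so that
  \<open>cheb k (2 * cos a) = sin ((k + 1/2) * a) / sin (a / 2)\<close>.\<close>

fun cheb :: "nat \<Rightarrow> complex \<Rightarrow> complex" where
  "cheb 0 w = 1"
| "cheb (Suc 0) w = w + 1"
| "cheb (Suc (Suc k)) w = w * cheb (Suc k) w - cheb k w"

text \<open>Powers of \<open>t\<close> and of its inverse both satisfy the recursion of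
  \<open>cheb\<close> at \<open>w = t + inverse t\<close>. With \<open>t\<close> a square, this is
  the link to the half-integral exponents of the Weyl formula.\<close>

lemma cheb_times:
  assumes "t \<noteq> 0"
  shows "(t - 1) * cheb k (t + inverse t) = t ^ (k + 1) - inverse t ^ k"
proof -
  define s where "s = inverse t"
  have st: "t * s = 1" using assms by (simp add: s_def)
  have "(t - 1) * cheb k (t + s) = t ^ (k + 1) - s ^ k"
  proof (induction k rule: cheb.induct[where P = "\<lambda>k _. (t - 1) * cheb k (t + s) = t ^ (k + 1) - s ^ k"])
    case 2
    have "(t - 1) * (t + s + 1) = t * t + t * s - s - 1" by (simp add: algebra_simps)
    then show ?case by (simp add: st)
  next
    case (3 k)
    have "(t - 1) * cheb (Suc (Suc k)) (t + s) =
        (t + s) * ((t - 1) * cheb (Suc k) (t + s)) - (t - 1) * cheb k (t + s)"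
      by (simp add: algebra_simps)
    also have "\<dots> = (t + s) * (t ^ (Suc k + 1) - s ^ Suc k) - (t ^ (k + 1) - s ^ k)"
      using 3 by simp
    also have "\<dots> = t ^ (Suc (Suc k) + 1) - s ^ Suc (Suc k) + (t * s - 1) * (t ^ (k + 1) - s ^ k)"
      by (simp add: algebra_simps)
    finally show ?case by (simp add: st)
  qed simp
  then show ?thesis by (simp add: s_def)
qed

lemma exists_plus_inverse: "\<exists>t::complex. t \<noteq> 0 \<and> t + inverse t = w"
proof -
  define t where "t = (w + csqrt (w\<^sup>2 - 4)) / 2"
  have "t * t + 1 - w * t = ((csqrt (w\<^sup>2 - 4))\<^sup>2 - (w\<^sup>2 - 4)) / 4"
    unfolding t_def by (simp add: field_simps power2_eq_square del: power2_csqrt)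
  then have eq: "t * t + 1 = w * t"
    by simp
  then have t: "t \<noteq> 0" by auto
  have "t + inverse t = (t * t + 1) / t" using t by (simp add: field_simps)
  with t eq show ?thesis by auto
qed

text \<open>Multiplied by \<open>t - 1\<close>, the right side is \<open>exp (x * w)\<close> times
  the difference of \<open>t powi (b + 1)\<close> and \<open>t powi (- b)\<close>. Two shifted
  copies of the generating function expand it over all integers \<open>m\<close> with terms
  \<open>c m\<close>, and folding the negative half onto the other gives the kernel. The assumption
  means \<open>t \<noteq> 1\<close>, so \<open>t - 1\<close> cancels.\<close>

lemma exp_cheb_has_sum:
  assumes w: "w \<noteq> 2"
  shows "((\<lambda>k. cheb k w * bessel_kernel x k b) has_sum exp (x * w) * cheb b w) UNIV"
proof -
  obtain t where t: "t \<noteq> 0" "w = t + inverse t"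
    using exists_plus_inverse[of w] by auto
  with w have t1: "t \<noteq> 1" by auto
  have sym: "bessel_I (int b - m) (2 * x) = bessel_I (m - int b) (2 * x)" for m
    using bessel_I_minus[of "m - int b" "2 * x"] by simp
  define c where "c m = bessel_I (m - int b) (2 * x) * (t powi (m + 1) - t powi (- m))" for m
  note gen = bessel_I_generating_function[OF t(1), of x, folded t(2)]
  have "((\<lambda>m. bessel_I (m - int b) (2 * x) * t powi (m - int b)) has_sum exp (x * w)) UNIV"
  proof -
    have "bij_betw (\<lambda>m. m - int b) UNIV UNIV"
      by (rule bij_betwI[where g = "\<lambda>m. m + int b"]) auto
    from has_sum_reindex_bij_betw[OF this, THEN iffD2, OF gen] show ?thesis .
  qed
  from has_sum_cmult_left[OF this, of "t powi (int b + 1)"]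
  have 1: "((\<lambda>m. bessel_I (m - int b) (2 * x) * t powi (m + 1)) has_sum exp (x * w) * t powi (int b + 1)) UNIV"
    using t(1) by (simp add: mult.assoc flip: power_int_add)
  have "((\<lambda>m. bessel_I (m - int b) (2 * x) * t powi (int b - m)) has_sum exp (x * w)) UNIV"
  proof -
    have "bij_betw (\<lambda>m. int b - m) UNIV UNIV"
      by (rule bij_betwI[where g = "\<lambda>m. int b - m"]) auto
    from has_sum_reindex_bij_betw[OF this, THEN iffD2, OF gen] show ?thesis
      by (simp only: sym)
  qed
  from has_sum_cmult_left[OF this, of "t powi (- int b)"]
  have 2: "((\<lambda>m. bessel_I (m - int b) (2 * x) * t powi (- m)) has_sum exp (x * w) * t powi (- int b)) UNIV"
    using t(1) by (simp add: mult.assoc flip: power_int_add)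
  define S where "S = exp (x * w) * (t powi (int b + 1) - t powi (- int b))"
  have c: "(c has_sum S) UNIV"
    using has_sum_add[OF 1 has_sum_uminusI[OF 2]] unfolding c_def[abs_def] S_def
    by (simp only: right_diff_distrib add_uminus_conv_diff)
  \<comment> \<open>The reflection of \<open>m\<close> to \<open>- 1 - m\<close> exchanges the two
    halves and changes the sign of the factor \<open>t powi (m + 1) - t powi (- m)\<close> in
    \<open>c m\<close>.\<close>
  have U: "UNIV = range int \<union> range (\<lambda>k. - 1 - int k)"
  proof (intro equalityI subsetI)
    fix m :: int
    show "m \<in> range int \<union> range (\<lambda>k. - 1 - int k)"
      by (cases "m \<ge> 0") (auto intro: image_eqI[of _ _ "nat m"] image_eqI[of _ _ "nat (- 1 - m)"])
  qed auto
  have sm: "c summable_on A" for A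
    using has_sum_imp_summable[OF c] by (rule summable_on_subset_banach) simp
  define S1 S2 where "S1 = infsum c (range int)" and "S2 = infsum c (range (\<lambda>k. - 1 - int k))"
  have h: "(c has_sum S1) (range int)" "(c has_sum S2) (range (\<lambda>k. - 1 - int k))"
    using sm by (auto simp: S1_def S2_def)
  have "(c has_sum S1 + S2) (range int \<union> range (\<lambda>k. - 1 - int k))"
    by (rule has_sum_Un_disjoint[OF h]) auto
  then have S: "S = S1 + S2"
    using c unfolding U[symmetric] by (rule has_sum_unique[rotated])
  have "((\<lambda>k. c (int k)) has_sum S1) UNIV" "((\<lambda>k. c (- 1 - int k)) has_sum S2) UNIV"
    using h has_sum_reindex[of int UNIV c S1] has_sum_reindex[of "\<lambda>k. - 1 - int k" UNIV c S2]
    by (simp_all add: inj_on_def o_def)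
  from has_sum_add[OF this]
  have "((\<lambda>k. c (int k) + c (- 1 - int k)) has_sum S) UNIV"
    by (simp add: S)
  also have "(\<lambda>k. c (int k) + c (- 1 - int k)) = (\<lambda>k. (t - 1) * (cheb k w * bessel_kernel x k b))"
  proof
    fix k
    have "c (int k) + c (- 1 - int k) = bessel_kernel x k b * (t powi (int k + 1) - t powi (- int k))"
      using bessel_I_minus[of "int k + int b + 1" "2 * x"]
      by (simp add: c_def bessel_kernel_def algebra_simps)
    also have "t powi (int k + 1) - t powi (- int k) = (t - 1) * cheb k w"
      using cheb_times[OF t(1), of k] t by (simp add: power_int_add power_int_minus power_inverse)
    finally show "c (int k) + c (- 1 - int k) = (t - 1) * (cheb k w * bessel_kernel x k b)"
      by simp
  qed
  also have "S = (t - 1) * (exp (x * w) * cheb b w)"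
    using cheb_times[OF t(1), of b] t by (simp add: S_def power_int_add power_int_minus power_inverse)
  finally show ?thesis
    using t1 by (subst (asm) has_sum_cmult_right_iff) auto
qed

section \<open>Divided differences and Weyl alternants\<close>

text \<open>The divided difference of \<open>cheb k\<close> at the nodes \<open>w m, \<dots>, w (N - 1)\<close>; the recursion is the one
  of \<open>cheb\<close>, combined with \<open>(z f)[w\<^sub>m, \<dots>] = w\<^sub>m f[w\<^sub>m, \<dots>] + f[w\<^sub>m\<^sub>+\<^sub>1, \<dots>]\<close>.\<close>

fun divided_difference :: "nat \<Rightarrow> (nat \<Rightarrow> complex) \<Rightarrow> nat \<Rightarrow> nat \<Rightarrow> complex" where
  "divided_difference N w 0 m = (if Suc m = N then 1 else 0)"
| "divided_difference N w (Suc 0) m =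
     (w m + 1) * divided_difference N w 0 m + divided_difference N w 0 (Suc m)"
| "divided_difference N w (Suc (Suc k)) m =
     w m * divided_difference N w (Suc k) m + divided_difference N w (Suc k) (Suc m)
       - divided_difference N w k m"

lemma divided_difference_outside: "N \<le> m \<Longrightarrow> divided_difference N w k m = 0"
  by (induction N w k m rule: divided_difference.induct) auto

text \<open>There are \<open>N - m\<close> nodes, more than \<open>k + 1\<close>, while
  \<open>cheb k\<close> has degree \<open>k\<close>.\<close>

lemma divided_difference_below_order: "Suc (k + m) < N \<Longrightarrow> divided_difference N w k m = 0"
  by (induction N w k m rule: divided_difference.induct) auto

text \<open>On exactly \<open>k + 1\<close> nodes the divided difference is the leading coefficient
  of the monic polynomial \<open>cheb k\<close>.\<close>

lemma divided_difference_top_order: "Suc (k + m) = N \<Longrightarrow> divided_difference N w k m = 1"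
  by (induction N w k m rule: divided_difference.induct)
    (auto simp: divided_difference_below_order)

text \<open>The bound depends on the nodes only through \<open>K\<close>, which later gives
  convergence uniform in the nodes.\<close>

lemma norm_divided_difference_le:
  assumes "\<And>i. i < N \<Longrightarrow> norm (w i) \<le> K" and "K \<ge> 0"
  shows "norm (divided_difference N w k m) \<le> (K + 3) ^ k"
  using assms(1)
proof (induction N w k m rule: divided_difference.induct)
  case (2 N w m)
  then have "Suc m = N \<Longrightarrow> norm (w m) \<le> K" by auto
  then show ?case
    using norm_triangle_ineq[of "w m" 1] assms(2) by auto
next
  case (3 N w k m)
  have K: "(K + 3) ^ k \<le> (K + 3) ^ Suc k"
    using assms(2) by (intro power_increasing) auto
  have "norm (w m * divided_difference N w (Suc k) m) \<le> K * (K + 3) ^ Suc k"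
  proof (cases "m < N")
    case True
    then show ?thesis
      unfolding norm_mult using 3 assms(2) by (intro mult_mono) auto
  next
    \<comment> \<open>Nothing bounds \<open>w m\<close> here, but its factor vanishes.\<close>
    case False
    then show ?thesis
      using assms(2) by (simp add: divided_difference_outside)
  qed
  then have "norm (divided_difference N w (Suc (Suc k)) m) \<le>
      K * (K + 3) ^ Suc k + (K + 3) ^ Suc k + (K + 3) ^ k"
    using 3 norm_triangle_ineq4[of "w m * divided_difference N w (Suc k) m + divided_difference N w (Suc k) (Suc m)"
        "divided_difference N w k m"]
      norm_triangle_ineq[of "w m * divided_difference N w (Suc k) m" "divided_difference N w (Suc k) (Suc m)"]
    by auto
  also have "\<dots> \<le> (K + 3) ^ Suc (Suc k)"
    using K assms(2) zero_le_power[of "K + 3" k] by (simp add: algebra_simps)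
  finally show ?case .
qed auto

lemma continuous_on_divided_difference:
  assumes "\<And>i. continuous_on S (\<lambda>e. w e i)"
  shows "continuous_on S (\<lambda>e. divided_difference N (w e) k m)"
proof -
  have "continuous_on S (\<lambda>e. divided_difference N (w e) k m) \<and>
    continuous_on S (\<lambda>e. divided_difference N (w e) (Suc k) m)" for k
    by (induction k arbitrary: m) (auto intro!: continuous_intros assms)
  then show ?thesis by blast
qed

text \<open>Nodes are used from the last one backwards, to match divided differences over the tails
  \<open>w m, \<dots>, w (N - 1)\<close>; \<open>m = N - 1\<close> gives the constant 1.\<close>

definition newton_basis :: "nat \<Rightarrow> (nat \<Rightarrow> complex) \<Rightarrow> nat \<Rightarrow> complex \<Rightarrow> complex" where
  "newton_basis N w m z = (\<Prod>q\<in>{m<..<N}. z - w q)"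

text \<open>Write \<open>w i\<close> as \<open>w m + (w i - w m)\<close>: the second summand turns
  basis element \<open>m\<close> into element \<open>m - 1\<close>. This is the recursion of
  \<open>divided_difference\<close> read on coefficients.\<close>

lemma newton_basis_mult:
  assumes i: "i < N" and a: "a N = 0"
  shows "w i * (\<Sum>m<N. a m * newton_basis N w m (w i)) =
    (\<Sum>m<N. (w m * a m + a (Suc m)) * newton_basis N w m (w i))"
proof -
  define p where "p m = (\<Prod>q\<in>{m..<N}. w i - w q)" for m
  have nb: "newton_basis N w m (w i) = p (Suc m)" for m
    by (simp add: newton_basis_def p_def atLeastSucLessThan_greaterThanLessThan)
  have p: "p m = (w i - w m) * p (Suc m)" if "m < N" for m
    using that by (simp add: p_def prod.atLeast_Suc_lessThan)
  \<comment> \<open>The shift leaves the basis at \<open>m = 0\<close>, where the product over all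
    nodes vanishes because \<open>w i\<close> is a node.\<close>
  have p0: "p 0 = 0"
    using i by (auto simp: p_def intro!: prod_zero)
  obtain M where N: "N = Suc M" using i by (cases N) auto
  have "(\<Sum>m<N. a m * p m) = (\<Sum>m<M. a (Suc m) * p (Suc m))"
    unfolding N sum.lessThan_Suc_shift by (simp add: p0)
  also have "\<dots> = (\<Sum>m<N. a (Suc m) * p (Suc m))"
    using a by (simp add: N)
  finally have shift: "(\<Sum>m<N. a m * p m) = (\<Sum>m<N. a (Suc m) * p (Suc m))" .
  have "w i * (\<Sum>m<N. a m * p (Suc m)) = (\<Sum>m<N. w m * a m * p (Suc m) + a m * p m)"
    unfolding sum_distrib_left by (intro sum.cong) (auto simp: p algebra_simps)
  also have "\<dots> = (\<Sum>m<N. (w m * a m + a (Suc m)) * p (Suc m))"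
    by (simp add: sum.distrib shift distrib_right)
  finally show ?thesis
    by (simp add: nb)
qed

text \<open>By \<open>newton_basis_mult\<close> both sides obey the same two-step recursion in
  \<open>k\<close>, so two consecutive values are carried through the induction.\<close>

lemma newton_interpolation_cheb:
  assumes i: "i < N"
  shows "cheb k (w i) = (\<Sum>m<N. divided_difference N w k m * newton_basis N w m (w i))"
proof -
  define D where "D = divided_difference N w"
  define n where "n m = newton_basis N w m (w i)" for m
  have step: "w i * (\<Sum>m<N. D k m * n m) = (\<Sum>m<N. (w m * D k m + D k (Suc m)) * n m)" for k
    unfolding n_def D_def by (rule newton_basis_mult[OF i]) (simp add: divided_difference_outside)
  have base: "(\<Sum>m<N. D 0 m * n m) = 1"
  proof -
    obtain M where N: "N = Suc M" using i by (cases N) auto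
    have "n M = 1"
      by (simp add: n_def N newton_basis_def flip: atLeastSucLessThan_greaterThanLessThan)
    then show ?thesis
      unfolding N sum.lessThan_Suc by (simp add: D_def N)
  qed
  have "cheb k (w i) = (\<Sum>m<N. D k m * n m) \<and> cheb (Suc k) (w i) = (\<Sum>m<N. D (Suc k) m * n m)"
  proof (induction k)
    case 0
    have "cheb (Suc 0) (w i) = w i * (\<Sum>m<N. D 0 m * n m) + (\<Sum>m<N. D 0 m * n m)"
      by (simp add: base)
    also have "\<dots> = (\<Sum>m<N. D (Suc 0) m * n m)"
      unfolding step sum.distrib[symmetric] by (intro sum.cong refl) (simp add: D_def algebra_simps)
    finally show ?case
      by (simp add: base)
  next
    case (Suc k)
    have "cheb (Suc (Suc k)) (w i) = w i * (\<Sum>m<N. D (Suc k) m * n m) - (\<Sum>m<N. D k m * n m)"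
      using Suc by simp
    also have "\<dots> = (\<Sum>m<N. D (Suc (Suc k)) m * n m)"
      unfolding step sum_subtractf[symmetric] by (intro sum.cong refl) (simp add: D_def algebra_simps)
    finally show ?case
      using Suc by simp
  qed
  then show ?thesis
    by (simp add: D_def n_def)
qed

section \<open>Newton and divided difference matrices\<close>

definition newton_mat :: "nat \<Rightarrow> (nat \<Rightarrow> complex) \<Rightarrow> complex mat" where
  "newton_mat N w = mat N N (\<lambda>(i, m). newton_basis N w m (w i))"

lemma newton_mat_carrier [simp]: "newton_mat N w \<in> carrier_mat N N"
  by (simp add: newton_mat_def)

text \<open>Below the diagonal the product contains the factor \<open>w i - w i\<close>; the
  diagonal gives the Vandermonde product.\<close>

lemma det_newton_mat: "det (newton_mat N w) = (\<Prod>i<N. \<Prod>q\<in>{i<..<N}. w i - w q)"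
proof -
  have "upper_triangular (newton_mat N w)"
    by (auto simp: upper_triangular_def newton_mat_def newton_basis_def intro!: prod_zero)
  then have "det (newton_mat N w) = prod_list (diag_mat (newton_mat N w))"
    by (intro det_upper_triangular[of _ N]) auto
  also have "\<dots> = (\<Prod>i<N. newton_basis N w i (w i))"
    by (simp add: diag_mat_def newton_mat_def prod.distinct_set_conv_list[symmetric] atLeast0LessThan)
  finally show ?thesis
    by (simp add: newton_basis_def)
qed

text \<open>For \<open>k\<close> a shifted weight, the determinant is the value of the character,
  also at coincident nodes.\<close>

definition dd_mat :: "nat \<Rightarrow> (nat \<Rightarrow> complex) \<Rightarrow> (nat \<Rightarrow> nat) \<Rightarrow> complex mat" where
  "dd_mat N w k = mat N N (\<lambda>(m, j). divided_difference N w (k j) m)"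

lemma newton_mat_mult_dd_mat:
  "newton_mat N w * dd_mat N w k = mat N N (\<lambda>(i, j). cheb (k j) (w i))"
  by (intro eq_matI)
    (auto simp: newton_mat_def dd_mat_def scalar_prod_def newton_interpolation_cheb
      atLeast0LessThan mult.commute)

lemma det_cheb_mat:
  "det (mat N N (\<lambda>(i, j). cheb (k j) (w i))) = det (newton_mat N w) * det (dd_mat N w k)"
  unfolding newton_mat_mult_dd_mat[symmetric]
  by (rule det_mult) (auto simp: dd_mat_def)

text \<open>Column \<open>j\<close> belongs to a monic polynomial of degree
  \<open>N - 1 - j\<close>, so the matrix is lower triangular with diagonal 1.\<close>

lemma det_dd_mat_staircase: "det (dd_mat N w (\<lambda>j. N - 1 - j)) = 1"
proof -
  have "det (dd_mat N w (\<lambda>j. N - 1 - j)) = prod_list (diag_mat (dd_mat N w (\<lambda>j. N - 1 - j)))"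
    by (rule det_lower_triangular[of N]) (auto simp: dd_mat_def divided_difference_below_order)
  also have "diag_mat (dd_mat N w (\<lambda>j. N - 1 - j)) = map (\<lambda>_. 1) [0..<N]"
    by (auto simp: diag_mat_def dd_mat_def divided_difference_top_order)
  finally show ?thesis
    by (simp add: map_replicate_const)
qed


section \<open>Weyl alternants through divided differences\<close>

lemma det_scale_rows:
  "det (mat n n (\<lambda>(i, j). c i * f i j)) = (\<Prod>i<n. c i) * det (mat n n (\<lambda>(i, j). f i j :: 'a :: comm_ring_1))"
proof -
  have *: "det (mat n n (\<lambda>(i, j). h i j)) = (\<Sum>p | p permutes {0..<n}. signof p * (\<Prod>i = 0..<n. h i (p i)))"
    for h :: "nat \<Rightarrow> nat \<Rightarrow> 'a"
    by (simp add: det_mat_eq)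
  show ?thesis
    unfolding * by (simp add: prod.distrib sum_distrib_left mult_ac atLeast0LessThan)
qed

text \<open>The weight plus half the sum of the positive roots, less 1/2 in each entry: the doubled
  exponents in \<open>weyl_alternant\<close> are
  \<open>2 * shifted_weight N n j + 1\<close>.\<close>

definition shifted_weight :: "nat \<Rightarrow> nat list \<Rightarrow> nat \<Rightarrow> nat" where
  "shifted_weight N n j = n ! j + (N - 1 - j)"

text \<open>By \<open>cheb_times\<close> at the square of \<open>s i\<close>, each entry of row
  \<open>i\<close> is \<open>s i - inverse (s i)\<close> times a value of \<open>cheb\<close>; the
  remaining determinant factors by \<open>det_cheb_mat\<close>.\<close>

lemma weyl_alternant_eq:
  assumes s: "\<And>i. i < N \<Longrightarrow> s i \<noteq> 0" and w: "\<And>i. i < N \<Longrightarrow> w i = (s i)\<^sup>2 + inverse ((s i)\<^sup>2)"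
  shows "weyl_alternant N n s = (\<Prod>i<N. s i - inverse (s i)) * det (newton_mat N w) *
    det (dd_mat N w (shifted_weight N n))"
proof -
  have entry: "s i powi a - s i powi (- a) = (s i - inverse (s i)) * cheb (shifted_weight N n j) (w i)"
    if "i < N" "j < N" "a = 2 * (int (n ! j) + int N - int (j + 1)) + 1" for i j a
  proof -
    define k where "k = shifted_weight N n j"
    have a: "a = int (2 * k + 1)"
      using that by (simp add: k_def shifted_weight_def)
    have "s i * ((s i - inverse (s i)) * cheb k (w i)) = ((s i)\<^sup>2 - 1) * cheb k (w i)"
      using s[OF that(1)] by (simp add: field_simps power2_eq_square)
    also have "\<dots> = (s i)\<^sup>2 ^ (k + 1) - inverse ((s i)\<^sup>2) ^ k"
      unfolding w[OF that(1)] using s[OF that(1)] by (intro cheb_times) simp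
    also have "\<dots> = s i * (s i powi a - s i powi (- a))"
      unfolding a power_int_minus power_int_of_nat using s[OF that(1)]
      by (simp add: field_simps power_mult[symmetric] power_inverse flip: power2_eq_square)
    finally show ?thesis
      using s[OF that(1)] by (simp add: k_def)
  qed
  have "weyl_alternant N n s =
      det (mat N N (\<lambda>(i, j). (s i - inverse (s i)) * cheb (shifted_weight N n j) (w i)))"
    unfolding weyl_alternant_def Let_def
    by (intro arg_cong[of _ _ det] cong_mat refl) (simp only: prod.case entry)
  then show ?thesis
    by (simp add: det_scale_rows det_cheb_mat)
qed

lemma dd_mat_cong: "(\<And>j. j < N \<Longrightarrow> k j = k' j) \<Longrightarrow> dd_mat N w k = dd_mat N w k'"
  by (auto simp: dd_mat_def)

lemma weyl_alternant_denominator: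
  assumes "\<And>i. i < N \<Longrightarrow> s i \<noteq> 0" "\<And>i. i < N \<Longrightarrow> w i = (s i)\<^sup>2 + inverse ((s i)\<^sup>2)"
  shows "weyl_alternant N (replicate N 0) s = (\<Prod>i<N. s i - inverse (s i)) * det (newton_mat N w)"
proof -
  have "dd_mat N w (shifted_weight N (replicate N 0)) = dd_mat N w (\<lambda>j. N - 1 - j)"
    by (rule dd_mat_cong) (simp add: shifted_weight_def)
  then have "det (dd_mat N w (shifted_weight N (replicate N 0))) = 1"
    by (simp only: det_dd_mat_staircase)
  then show ?thesis
    using weyl_alternant_eq[OF assms] by simp
qed

section \<open>Bessel series of divided differences\<close>

lemma divided_difference_bessel_bound:
  assumes "\<And>i. i < N \<Longrightarrow> norm (w i) \<le> K" and "K \<ge> 0"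
  shows "norm (divided_difference N w k m * bessel_kernel x k b) \<le> norm (bessel_kernel x k b) * (K + 3) ^ k"
  using norm_divided_difference_le[OF assms, where k = k and m = m]
  by (simp add: norm_mult mult.commute mult_left_mono)

lemma divided_difference_bessel_summable:
  "(\<lambda>k. divided_difference N w k m * bessel_kernel x k b) summable_on UNIV"
proof -
  define K where "K = (\<Sum>i<N. norm (w i))"
  have K: "norm (w i) \<le> K" if "i < N" for i
    unfolding K_def using that by (intro member_le_sum) auto
  have "K \<ge> 0" by (simp add: K_def sum_nonneg)
  then have "(\<lambda>k. divided_difference N w k m * bessel_kernel x k b) abs_summable_on UNIV"
    using divided_difference_bessel_bound[OF K]
    by (intro abs_summable_on_comparison_test'[OF bessel_kernel_summable[of "K + 3" x b]]) auto
  then show ?thesis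
    by (rule abs_summable_summable)
qed

text \<open>Termwise divided differences of the Chebyshev series of
  \<open>exp (x * z) * cheb (N - 1 - j) z\<close>.\<close>

definition bessel_dd_mat :: "nat \<Rightarrow> complex \<Rightarrow> (nat \<Rightarrow> complex) \<Rightarrow> complex mat" where
  "bessel_dd_mat N x w =
     mat N N (\<lambda>(m, j). \<Sum>\<^sub>\<infinity>k. divided_difference N w k m * bessel_kernel x k (N - 1 - j))"

text \<open>Multiplying by \<open>newton_mat\<close> restores the values
  \<open>exp (x * w i) * cheb (N - 1 - j) (w i)\<close>. Their determinant is the product of the
  exponentials times \<open>det (newton_mat N w)\<close>, which is nonzero for distinct nodes and
  cancels.\<close>

lemma det_bessel_dd_mat_generic:
  assumes w: "\<And>i. i < N \<Longrightarrow> w i \<noteq> 2" and distinct: "\<And>i j. i < j \<Longrightarrow> j < N \<Longrightarrow> w i \<noteq> w j"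
  shows "det (bessel_dd_mat N x w) = (\<Prod>i<N. exp (x * w i))"
proof -
  have entry: "(\<Sum>m<N. newton_basis N w m (w i) * (\<Sum>\<^sub>\<infinity>k. divided_difference N w k m * bessel_kernel x k b)) =
      exp (x * w i) * cheb b (w i)" if "i < N" for i b
  proof (rule has_sum_unique)
    show "((\<lambda>k. \<Sum>m<N. newton_basis N w m (w i) * (divided_difference N w k m * bessel_kernel x k b)) has_sum
      (\<Sum>m<N. newton_basis N w m (w i) * (\<Sum>\<^sub>\<infinity>k. divided_difference N w k m * bessel_kernel x k b))) UNIV"
      by (intro has_sum_sum has_sum_cmult_right) (auto simp: divided_difference_bessel_summable)
    have "(\<lambda>k. \<Sum>m<N. newton_basis N w m (w i) * (divided_difference N w k m * bessel_kernel x k b)) =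
        (\<lambda>k. cheb k (w i) * bessel_kernel x k b)"
      by (simp add: newton_interpolation_cheb[OF that] sum_distrib_left mult_ac)
    then show "((\<lambda>k. \<Sum>m<N. newton_basis N w m (w i) * (divided_difference N w k m * bessel_kernel x k b)) has_sum
        exp (x * w i) * cheb b (w i)) UNIV"
      using exp_cheb_has_sum[OF w[OF that], of x b] by simp
  qed
  have "newton_mat N w * bessel_dd_mat N x w = mat N N (\<lambda>(i, j). exp (x * w i) * cheb (N - 1 - j) (w i))"
    by (intro eq_matI) (auto simp: newton_mat_def bessel_dd_mat_def scalar_prod_def entry atLeast0LessThan)
  then have "det (newton_mat N w) * det (bessel_dd_mat N x w) =
      det (mat N N (\<lambda>(i, j). exp (x * w i) * cheb (N - 1 - j) (w i)))"
    by (subst det_mult[symmetric, of _ N]) (auto simp: bessel_dd_mat_def)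
  also have "\<dots> = (\<Prod>i<N. exp (x * w i)) * det (newton_mat N w)"
    by (simp only: det_scale_rows det_cheb_mat det_dd_mat_staircase mult_1_right)
  finally show ?thesis
    using distinct by (auto simp: det_newton_mat)
qed

text \<open>Both sides are continuous in \<open>w\<close>, so the excluded coincidences can be approached along the line
  \<open>w i + e * (i + 1)\<close>.\<close>
lemma det_bessel_dd_mat:
  "det (bessel_dd_mat N x w) = (\<Prod>i<N. exp (x * w i))"
proof -
  define v where "v e i = w i + e * of_nat (Suc i)" for e :: complex and i
  define K where "K = (\<Sum>i<N. norm (w i) + real (Suc i))"
  have K: "norm (v e i) \<le> K" if "i < N" "e \<in> cball 0 1" for e i
  proof -
    have "norm (v e i) \<le> norm (w i) + norm e * real (Suc i)"
      unfolding v_def by (rule order_trans[OF norm_triangle_ineq]) (simp add: norm_mult del: of_nat_Suc)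
    also have "\<dots> \<le> norm (w i) + real (Suc i)"
      using that(2) mult_right_mono[of "norm e" 1 "real (Suc i)"] by simp
    also have "\<dots> \<le> K"
      unfolding K_def using that(1) by (intro member_le_sum) auto
    finally show ?thesis .
  qed
  have K0: "K \<ge> 0" by (simp add: K_def sum_nonneg)
  have cont: "continuous_on (cball 0 1) (\<lambda>e. \<Sum>\<^sub>\<infinity>k. divided_difference N (v e) k m * bessel_kernel x k b)" for m b
  proof (rule uniform_limit_theorem)
    show "uniform_limit (cball 0 1) (\<lambda>X e. \<Sum>k\<in>X. divided_difference N (v e) k m * bessel_kernel x k b)
        (\<lambda>e. \<Sum>\<^sub>\<infinity>k. divided_difference N (v e) k m * bessel_kernel x k b) (finite_subsets_at_top UNIV)"
      \<comment> \<open>\<open>K\<close> bounds all nodes \<open>v e i\<close> on the whole disk, so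
        the majorant is independent of \<open>e\<close>.\<close>
      by (rule Weierstrass_m_test_general[OF _ bessel_kernel_summable[of "K + 3" x b]])
        (use K K0 in \<open>auto intro!: divided_difference_bessel_bound\<close>)
    show "\<forall>\<^sub>F X in finite_subsets_at_top UNIV.
        continuous_on (cball 0 1) (\<lambda>e. \<Sum>k\<in>X. divided_difference N (v e) k m * bessel_kernel x k b)"
      by (intro always_eventually allI continuous_intros continuous_on_divided_difference)
        (auto simp: v_def intro!: continuous_intros)
  qed simp
  define f where "f e = det (bessel_dd_mat N x (v e)) - (\<Prod>i<N. exp (x * v e i))" for e
  have "continuous_on (cball 0 1) f"
    unfolding f_def bessel_dd_mat_def det_mat_eq prod.case
    by (intro continuous_intros cont) (auto simp: v_def intro!: continuous_intros)
  then have "isCont f 0"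
    by (rule continuous_on_interior) (simp add: interior_cball)
  then have lim: "(f \<longlongrightarrow> f 0) (at 0)"
    by (simp add: isCont_def)
  have "\<forall>\<^sub>F e in at 0. \<forall>i\<in>{..<N}. v e i \<noteq> 2"
  proof (intro eventually_ball_finite ballI finite_lessThan)
    fix i
    have "\<forall>\<^sub>F e in at 0. e \<noteq> (2 - w i) / of_nat (Suc i)"
      by (rule eventually_neq_at_within)
    then show "\<forall>\<^sub>F e in at 0. v e i \<noteq> 2"
      by eventually_elim (auto simp: v_def field_simps simp del: of_nat_Suc)
  qed
  moreover have "\<forall>\<^sub>F e in at 0. \<forall>i\<in>{..<N}. \<forall>j\<in>{..<N}. i < j \<longrightarrow> v e i \<noteq> v e j"
  proof (intro eventually_ball_finite ballI finite_lessThan)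
    fix i j
    \<comment> \<open>Different slopes let two nodes meet for one value of \<open>e\<close> only; if
      that value is 0, the punctured neighbourhood omits it.\<close>
    have "\<forall>\<^sub>F e in at 0. e \<noteq> (w i - w j) / (of_nat j - of_nat i)"
      by (rule eventually_neq_at_within)
    then show "\<forall>\<^sub>F e in at 0. i < j \<longrightarrow> v e i \<noteq> v e j"
      by eventually_elim (auto simp: v_def field_simps)
  qed
  ultimately have "\<forall>\<^sub>F e in at 0. f e = 0"
    by eventually_elim (auto simp: f_def det_bessel_dd_mat_generic)
  then have "(f \<longlongrightarrow> 0) (at 0)"
    by (rule tendsto_eventually)
  from tendsto_unique[OF _ lim this] have "f 0 = 0"
    by simp
  then show ?thesis
    by (simp add: f_def v_def[abs_def])
qed

section \<open>Characters as Laurent polynomials\<close>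

text \<open>Agreement is asked only at nonzero coordinates, where exponents add under
  multiplication.\<close>

definition is_laurent :: "nat \<Rightarrow> ((nat \<Rightarrow> complex) \<Rightarrow> complex) \<Rightarrow> bool" where
  "is_laurent N f \<longleftrightarrow>
     (\<exists>p. laurent_in_vars N p \<and> (\<forall>t. (\<forall>i<N. t i \<noteq> 0) \<longrightarrow> laurent_eval p t = f t))"

definition laurent_monomial :: "nat \<Rightarrow> (nat \<Rightarrow>\<^sub>0 int) \<Rightarrow> (nat \<Rightarrow> complex) \<Rightarrow> complex" where
  "laurent_monomial N e t = (\<Prod>i<N. t i powi Poly_Mapping.lookup e i)"

text \<open>A common finite index set lets several polynomials be added or compared
  coefficientwise.\<close>

lemma laurent_eval_superset:
  assumes "laurent_in_vars N p" "finite S" "Poly_Mapping.keys p \<subseteq> S"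
  shows "laurent_eval p t = (\<Sum>e\<in>S. Poly_Mapping.lookup p e * laurent_monomial N e t)"
proof -
  have "(\<Prod>i\<in>Poly_Mapping.keys e. t i powi Poly_Mapping.lookup e i) = laurent_monomial N e t"
    if "e \<in> Poly_Mapping.keys p" for e
    unfolding laurent_monomial_def
    using assms(1) that by (intro prod.mono_neutral_left) (auto simp: laurent_in_vars_def in_keys_iff)
  then show ?thesis
    unfolding laurent_eval_def
    by (intro sum.mono_neutral_cong_left) (use assms in \<open>auto simp: in_keys_iff\<close>)
qed

lemma laurent_monomial_add:
  assumes "\<forall>i<N. t i \<noteq> 0"
  shows "laurent_monomial N (e + e') t = laurent_monomial N e t * laurent_monomial N e' t"
  using assms unfolding laurent_monomial_def prod.distrib[symmetric]
  by (intro prod.cong) (auto simp: lookup_add power_int_add)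

lemma is_laurent_monomial:
  assumes "Poly_Mapping.keys e \<subseteq> {..<N}"
  shows "is_laurent N (\<lambda>t. c * laurent_monomial N e t)"
proof -
  have "laurent_in_vars N (Poly_Mapping.single e c)"
    using assms by (auto simp: laurent_in_vars_def split: if_splits)
  moreover from laurent_eval_superset[OF this, of "{e}"]
  have "laurent_eval (Poly_Mapping.single e c) t = c * laurent_monomial N e t" for t
    by (auto split: if_splits)
  ultimately show ?thesis
    unfolding is_laurent_def by blast
qed

lemma is_laurent_add:
  assumes "is_laurent N f" "is_laurent N g"
  shows "is_laurent N (\<lambda>t. f t + g t)"
proof -
  obtain p q where p: "laurent_in_vars N p" "\<And>t. (\<forall>i<N. t i \<noteq> 0) \<Longrightarrow> laurent_eval p t = f t"
    and q: "laurent_in_vars N q" "\<And>t. (\<forall>i<N. t i \<noteq> 0) \<Longrightarrow> laurent_eval q t = g t"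
    using assms unfolding is_laurent_def by blast
  have pq: "laurent_in_vars N (p + q)"
    using p(1) q(1) Poly_Mapping.keys_add[of p q] by (auto simp: laurent_in_vars_def)
  define S where "S = Poly_Mapping.keys p \<union> Poly_Mapping.keys q"
  have S: "finite S" "Poly_Mapping.keys p \<subseteq> S" "Poly_Mapping.keys q \<subseteq> S" "Poly_Mapping.keys (p + q) \<subseteq> S"
    using Poly_Mapping.keys_add[of p q] by (auto simp: S_def)
  have "laurent_eval (p + q) t = laurent_eval p t + laurent_eval q t" for t
    by (simp add: laurent_eval_superset[OF pq S(1,4)] laurent_eval_superset[OF p(1) S(1,2)]
        laurent_eval_superset[OF q(1) S(1,3)] lookup_add distrib_right sum.distrib)
  then show ?thesis
    using pq p(2) q(2) unfolding is_laurent_def by auto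
qed

lemma is_laurent_const: "is_laurent N (\<lambda>_. c)"
  using is_laurent_monomial[of 0 N c] by (simp add: laurent_monomial_def)

lemma is_laurent_sum:
  assumes "\<And>a. a \<in> A \<Longrightarrow> is_laurent N (f a)"
  shows "is_laurent N (\<lambda>t. \<Sum>a\<in>A. f a t)"
  using assms by (induction A rule: infinite_finite_induct) (auto intro: is_laurent_const is_laurent_add)

lemma is_laurent_cong:
  assumes "is_laurent N f" and "\<And>t. (\<forall>i<N. t i \<noteq> 0) \<Longrightarrow> f t = g t"
  shows "is_laurent N g"
  using assms unfolding is_laurent_def by force

text \<open>The product polynomial is never formed: the product of values is a double sum of
  monomials, and closure under sums applies.\<close>

lemma is_laurent_mult:
  assumes "is_laurent N f" "is_laurent N g"
  shows "is_laurent N (\<lambda>t. f t * g t)"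
proof -
  obtain p q where p: "laurent_in_vars N p" "\<And>t. (\<forall>i<N. t i \<noteq> 0) \<Longrightarrow> laurent_eval p t = f t"
    and q: "laurent_in_vars N q" "\<And>t. (\<forall>i<N. t i \<noteq> 0) \<Longrightarrow> laurent_eval q t = g t"
    using assms unfolding is_laurent_def by blast
  have "is_laurent N (\<lambda>t. \<Sum>e\<in>Poly_Mapping.keys p. \<Sum>e'\<in>Poly_Mapping.keys q.
      (Poly_Mapping.lookup p e * Poly_Mapping.lookup q e') * laurent_monomial N (e + e') t)"
  proof (intro is_laurent_sum is_laurent_monomial)
    fix e e' assume "e \<in> Poly_Mapping.keys p" "e' \<in> Poly_Mapping.keys q"
    then show "Poly_Mapping.keys (e + e') \<subseteq> {..<N}"
      using p(1) q(1) Poly_Mapping.keys_add[of e e'] by (fastforce simp: laurent_in_vars_def)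
  qed
  then show ?thesis
  proof (rule is_laurent_cong)
    fix t :: "nat \<Rightarrow> complex" assume t: "\<forall>i<N. t i \<noteq> 0"
    show "(\<Sum>e\<in>Poly_Mapping.keys p. \<Sum>e'\<in>Poly_Mapping.keys q.
      (Poly_Mapping.lookup p e * Poly_Mapping.lookup q e') * laurent_monomial N (e + e') t) = f t * g t"
      unfolding p(2)[OF t, symmetric] q(2)[OF t, symmetric]
      by (simp add: laurent_eval_superset[OF p(1) finite_keys order_refl]
          laurent_eval_superset[OF q(1) finite_keys order_refl]
          sum_product laurent_monomial_add[OF t] mult_ac)
  qed
qed

lemma is_laurent_prod:
  assumes "\<And>a. a \<in> A \<Longrightarrow> is_laurent N (f a)"
  shows "is_laurent N (\<lambda>t. \<Prod>a\<in>A. f a t)"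
  using assms by (induction A rule: infinite_finite_induct) (auto intro: is_laurent_const is_laurent_mult)

lemma is_laurent_var:
  assumes "i < N"
  shows "is_laurent N (\<lambda>t. t i powi a)"
proof -
  have "laurent_monomial N (Poly_Mapping.single i a) t = t i powi a" for t
  proof -
    have "laurent_monomial N (Poly_Mapping.single i a) t = (\<Prod>j\<in>{i}. t j powi Poly_Mapping.lookup (Poly_Mapping.single i a) j)"
      unfolding laurent_monomial_def
      using assms by (intro prod.mono_neutral_right) (auto simp: lookup_single when_def)
    then show ?thesis by simp
  qed
  then show ?thesis
    using is_laurent_monomial[of "Poly_Mapping.single i a" N 1] assms by (auto split: if_splits)
qed

lemma is_laurent_divided_difference:
  "is_laurent N (\<lambda>t. divided_difference N (\<lambda>i. t i + inverse (t i)) k m)"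
proof -
  define D where "D k m t = divided_difference N (\<lambda>i. t i + inverse (t i)) k m" for k m t
  have W: "is_laurent N (\<lambda>t. (t m + inverse (t m)) * D k m t)" if "is_laurent N (D k m)" for k m
  proof (cases "m < N")
    case True
    have "is_laurent N (\<lambda>t. t m + inverse (t m))"
      using is_laurent_add[OF is_laurent_var[OF True, of 1] is_laurent_var[OF True, of "- 1"]]
      by (simp add: power_int_minus)
    then show ?thesis using that by (rule is_laurent_mult)
  next
    case False
    then show ?thesis
      by (simp add: D_def divided_difference_outside is_laurent_const)
  qed
  have neg: "is_laurent N (\<lambda>t. f t - g t)" if "is_laurent N f" "is_laurent N g" for f g
    using is_laurent_add[OF that(1) is_laurent_mult[OF is_laurent_const[of N "- 1"] that(2)]] by simp
  have "is_laurent N (D k m) \<and> is_laurent N (D (Suc k) m)" for k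
  proof (induction k arbitrary: m)
    case 0
    have 0: "is_laurent N (D 0 m)" for m
      unfolding D_def by (simp add: is_laurent_const)
    have "is_laurent N (\<lambda>t. (t m + inverse (t m)) * D 0 m t + D 0 m t + D 0 (Suc m) t)"
      by (intro is_laurent_add W 0)
    then show ?case
      using 0 by (simp add: D_def[abs_def] distrib_right)
  next
    case (Suc k)
    have "is_laurent N (\<lambda>t. (t m + inverse (t m)) * D (Suc k) m t + D (Suc k) (Suc m) t - D k m t)"
      by (intro is_laurent_add neg W) (use Suc in auto)
    then show ?case
      using Suc[of m] by (simp add: D_def[abs_def])
  qed
  then show ?thesis
    by (simp add: D_def[abs_def])
qed

lemma is_laurent_det_dd_mat:
  "is_laurent N (\<lambda>t. det (dd_mat N (\<lambda>i. t i + inverse (t i)) k))"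
  unfolding dd_mat_def det_mat_eq prod.case
  by (intro is_laurent_sum is_laurent_mult is_laurent_const is_laurent_prod is_laurent_divided_difference)

section \<open>Uniqueness of the Laurent polynomial of a character\<close>

text \<open>Substituting \<open>t i = z ^ (2 * M ^ i)\<close> turns distinct monomials into distinct powers of \<open>z\<close>, which
  makes a Laurent polynomial in several variables determined by its values on a curve.\<close>
lemma exists_separating_base:
  fixes S :: "(nat \<Rightarrow>\<^sub>0 int) set"
  assumes "finite S" and "\<And>e. e \<in> S \<Longrightarrow> Poly_Mapping.keys e \<subseteq> {..<N}"
  shows "\<exists>M\<ge>2. inj_on (\<lambda>e. \<Sum>i<N. Poly_Mapping.lookup e i * int M ^ i) S"
proof -
  \<comment> \<open>Two exponent vectors collide at base \<open>M\<close> exactly if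
    \<open>M\<close> is a root of this polynomial. It is nonzero for distinct vectors in
    \<open>S\<close>, so only finitely many bases are bad.\<close>
  define P where "P e e' = (\<Sum>i<N. monom (Poly_Mapping.lookup e i - Poly_Mapping.lookup e' i) i)"
    for e e' :: "nat \<Rightarrow>\<^sub>0 int"
  define bad where "bad = (\<Union>(e, e')\<in>{(e, e')\<in>S \<times> S. e \<noteq> e'}. {M. poly (P e e') (int M) = 0})"
  have nz: "P e e' \<noteq> 0" if "e \<in> S" "e' \<in> S" "e \<noteq> e'" for e e'
  proof
    assume "P e e' = 0"
    have "Poly_Mapping.lookup e i = Poly_Mapping.lookup e' i" for i
    proof (cases "i < N")
      case True
      have "coeff (P e e') i = Poly_Mapping.lookup e i - Poly_Mapping.lookup e' i"
        unfolding P_def coeff_sum using True by (simp add: sum.delta)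
      then show ?thesis using \<open>P e e' = 0\<close> by simp
    next
      case False
      then have "i \<notin> Poly_Mapping.keys e" "i \<notin> Poly_Mapping.keys e'"
        using that assms(2) by auto
      then show ?thesis by (simp add: in_keys_iff)
    qed
    then show False
      using that(3) by (auto intro: poly_mapping_eqI)
  qed
  have "finite bad"
    unfolding bad_def
  proof (intro finite_UN_I)
    show "finite {(e, e')\<in>S \<times> S. e \<noteq> e'}"
      by (rule finite_subset[of _ "S \<times> S"]) (use assms(1) in auto)
    show "finite (case x of (e, e') \<Rightarrow> {M. poly (P e e') (int M) = 0})"
      if "x \<in> {(e, e')\<in>S \<times> S. e \<noteq> e'}" for x
    proof -
      obtain e e' where x: "x = (e, e')" "P e e' \<noteq> 0"
        using \<open>x \<in> _\<close> nz by auto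
      have "finite (int -` {M. poly (P e e') M = 0})"
        using poly_roots_finite[OF x(2)] by (rule finite_vimageI) simp
      then show ?thesis by (simp add: x(1) vimage_def)
    qed
  qed
  then obtain M where "M \<notin> bad \<union> {0, 1}"
    using ex_new_if_finite[of "bad \<union> {0, 1}"] infinite_UNIV_nat by auto
  then have M: "M \<notin> bad" "M \<ge> 2" by auto
  have "inj_on (\<lambda>e. \<Sum>i<N. Poly_Mapping.lookup e i * int M ^ i) S"
  proof (rule inj_onI, rule ccontr)
    fix e e' assume e: "e \<in> S" "e' \<in> S" "e \<noteq> e'"
      and eq: "(\<Sum>i<N. Poly_Mapping.lookup e i * int M ^ i) = (\<Sum>i<N. Poly_Mapping.lookup e' i * int M ^ i)"
    have "poly (P e e') (int M) = 0"
      using eq by (simp add: P_def poly_sum poly_monom left_diff_distrib sum_subtractf)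
    then have "M \<in> bad"
      using e by (auto simp: bad_def)
    with M show False by simp
  qed
  with M(2) show ?thesis by blast
qed

text \<open>Multiplying by \<open>z ^ K\<close> clears the negative exponents and leaves a
  polynomial with infinitely many roots; injectivity of \<open>d\<close> keeps its coefficients
  apart.\<close>

lemma powi_sum_eq_0_imp_coeff_eq_0:
  fixes c :: "'a \<Rightarrow> complex" and d :: "'a \<Rightarrow> int"
  assumes "finite S" "inj_on d S" and zero: "\<And>z::real. z > 1 \<Longrightarrow> (\<Sum>e\<in>S. c e * of_real z powi d e) = 0"
    and "e \<in> S"
  shows "c e = 0"
proof -
  define K where "K = (\<Sum>e\<in>S. nat \<bar>d e\<bar>)"
  have K: "d e + int K \<ge> 0" if "e \<in> S" for e
  proof -
    have "nat \<bar>d e\<bar> \<le> K"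
      unfolding K_def using assms(1) that by (intro member_le_sum) auto
    then show ?thesis by linarith
  qed
  define p where "p = (\<Sum>e\<in>S. monom (c e) (nat (d e + int K)))"
  have "poly p (of_real z) = 0" if "z > 1" for z
  proof -
    have "poly p (of_real z) = (\<Sum>e\<in>S. c e * of_real z powi (d e + int K))"
      unfolding p_def poly_sum poly_monom
    proof (intro sum.cong refl)
      fix e assume "e \<in> S"
      from K[OF this] show "c e * of_real z ^ nat (d e + int K) = c e * of_real z powi (d e + int K)"
        by (simp add: power_int_def)
    qed
    also have "\<dots> = (\<Sum>e\<in>S. c e * of_real z powi d e) * of_real z ^ K"
      using that by (simp add: power_int_add sum_distrib_right mult.assoc)
    finally show ?thesis
      using zero[OF that] by simp
  qed
  then have "of_real ` {1<..} \<subseteq> {z. poly p z = 0}"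
    by auto
  moreover have "infinite (complex_of_real ` {1<..})"
    by (subst finite_image_iff) (auto simp: inj_on_def infinite_Ioi)
  ultimately have "p = 0"
    using poly_roots_finite infinite_super by blast
  have "coeff p (nat (d e + int K)) = (\<Sum>e'\<in>S. if e' = e then c e' else 0)"
    unfolding p_def coeff_sum
  proof (intro sum.cong refl)
    fix e' assume "e' \<in> S"
    then have "nat (d e' + int K) = nat (d e + int K) \<longleftrightarrow> e' = e"
      using K[of e] K[of e'] \<open>e \<in> S\<close> inj_onD[OF assms(2), of e e'] by (auto simp: eq_nat_nat_iff)
    then show "coeff (monom (c e') (nat (d e' + int K))) (nat (d e + int K)) = (if e' = e then c e' else 0)"
      by simp
  qed
  then show ?thesis
    using \<open>p = 0\<close> \<open>e \<in> S\<close> assms(1) by simp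
qed

lemma plus_inverse_inj:
  fixes a b :: real
  assumes "a > 1" "b > 1" "a + inverse a = b + inverse b"
  shows "a = b"
proof -
  have "(a - b) * (a * b - 1) = 0"
    using assms by (simp add: field_simps)
  moreover have "a * b > 1"
    using assms less_1_mult by blast
  ultimately show ?thesis by simp
qed

text \<open>Along the curve the squares of the \<open>s i\<close> are distinct reals above 1, so no
  factor \<open>s i - inverse (s i)\<close> vanishes and the nodes are distinct. The curve thus
  stays where the Weyl quotient prescribes the values.\<close>

lemma weyl_alternant_denominator_nonzero:
  fixes z :: real
  assumes z: "z > 1" and M: "M \<ge> 2"
  shows "weyl_alternant N (replicate N 0) (\<lambda>i. of_real z ^ (M ^ i)) \<noteq> 0"
proof -
  define a where "a i = z ^ (2 * M ^ i)" for i
  define w where "w i = complex_of_real (a i + inverse (a i))" for i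
  have a1: "a i > 1" for i
    using z M by (simp add: a_def one_less_power)
  have a_inj: "a i \<noteq> a j" if "i < j" for i j
    using that z M by (simp add: a_def power_inject_exp)
  have "weyl_alternant N (replicate N 0) (\<lambda>i. of_real z ^ (M ^ i)) =
      (\<Prod>i<N. of_real z ^ (M ^ i) - inverse (of_real z ^ (M ^ i))) * det (newton_mat N w)"
    using z by (intro weyl_alternant_denominator) (auto simp: w_def a_def power_mult[symmetric] mult.commute)
  moreover have "complex_of_real z ^ (M ^ i) - inverse (of_real z ^ (M ^ i)) \<noteq> 0" for i
  proof
    assume *: "complex_of_real z ^ (M ^ i) - inverse (of_real z ^ (M ^ i)) = 0"
    define u where "u = z ^ (M ^ i)"
    have u: "u > 1" using z M by (simp add: u_def one_less_power)
    have "complex_of_real (u - inverse u) = 0"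
      using * by (simp add: u_def)
    then have "u = inverse u"
      unfolding of_real_eq_0_iff by simp
    then show False
      using u one_less_inverse_iff[of u] by linarith
  qed
  moreover have "w i \<noteq> w j" if "i < j" for i j
    using plus_inverse_inj[OF a1 a1, of i j] a_inj[OF that] unfolding w_def of_real_eq_iff by blast
  then have "det (newton_mat N w) \<noteq> 0"
    by (auto simp: det_newton_mat)
  ultimately show ?thesis
    by simp
qed

text \<open>This is the uniqueness behind the definite description in
  \<open>weyl_character\<close>.\<close>

lemma laurent_eqI:
  assumes p: "laurent_in_vars N p" and q: "laurent_in_vars N q"
    and eq: "\<And>s. \<forall>i<N. s i \<noteq> 0 \<Longrightarrow> weyl_alternant N (replicate N 0) s \<noteq> 0 \<Longrightarrow>
      laurent_eval p (\<lambda>i. (s i)\<^sup>2) = laurent_eval q (\<lambda>i. (s i)\<^sup>2)"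
  shows "p = q"
proof -
  define S where "S = Poly_Mapping.keys p \<union> Poly_Mapping.keys q"
  have S: "finite S" "Poly_Mapping.keys p \<subseteq> S" "Poly_Mapping.keys q \<subseteq> S"
    by (auto simp: S_def)
  obtain M where M: "M \<ge> 2" and inj: "inj_on (\<lambda>e. \<Sum>i<N. Poly_Mapping.lookup e i * int M ^ i) S"
    using exists_separating_base[OF S(1), of N] p q by (auto simp: S_def laurent_in_vars_def)
  \<comment> \<open>The factor 2 appears because the polynomials are evaluated at squares of the
    \<open>s i\<close>.\<close>
  define d where "d e = 2 * (\<Sum>i<N. Poly_Mapping.lookup e i * int M ^ i)" for e :: "nat \<Rightarrow>\<^sub>0 int"
  have mono: "laurent_monomial N e (\<lambda>i. (of_real z ^ (M ^ i))\<^sup>2) = of_real z powi d e"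
    if "z > 1" for z :: real and e
  proof -
    have "of_real z powi (\<Sum>i<k. 2 * (Poly_Mapping.lookup e i * int M ^ i)) =
        (\<Prod>i<k. ((of_real z :: complex) ^ (M ^ i))\<^sup>2 powi Poly_Mapping.lookup e i)" for k
    proof (induction k)
      case (Suc k)
      have "((complex_of_real z) ^ (M ^ k))\<^sup>2 powi Poly_Mapping.lookup e k =
          of_real z powi (2 * (Poly_Mapping.lookup e k * int M ^ k))"
      proof -
        have "((complex_of_real z) ^ (M ^ k))\<^sup>2 = of_real z powi int (M ^ k * 2)"
          by (simp only: power_int_of_nat power_mult)
        then have "((complex_of_real z) ^ (M ^ k))\<^sup>2 powi Poly_Mapping.lookup e k =
            of_real z powi (int (M ^ k * 2) * Poly_Mapping.lookup e k)"
          by (simp only: power_int_mult)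
        also have "int (M ^ k * 2) * Poly_Mapping.lookup e k = 2 * (Poly_Mapping.lookup e k * int M ^ k)"
          by simp
        finally show ?thesis .
      qed
      then show ?case
        using Suc that by (simp add: power_int_add)
    qed simp
    then show ?thesis
      by (simp add: laurent_monomial_def d_def sum_distrib_left)
  qed
  have "Poly_Mapping.lookup p e - Poly_Mapping.lookup q e = 0" if "e \<in> S" for e
  proof (rule powi_sum_eq_0_imp_coeff_eq_0[OF S(1) _ _ that])
    show "inj_on d S"
      using inj by (auto simp: inj_on_def d_def)
    fix z :: real assume z: "z > 1"
    have "laurent_eval p (\<lambda>i. (of_real z ^ (M ^ i))\<^sup>2) = laurent_eval q (\<lambda>i. (of_real z ^ (M ^ i))\<^sup>2)"
      using z by (intro eq weyl_alternant_denominator_nonzero M) auto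
    then show "(\<Sum>e\<in>S. (Poly_Mapping.lookup p e - Poly_Mapping.lookup q e) * of_real z powi d e) = 0"
      by (simp add: laurent_eval_superset[OF p S(1,2)] laurent_eval_superset[OF q S(1,3)] mono[OF z]
          left_diff_distrib sum_subtractf)
  qed
  moreover have "Poly_Mapping.lookup p e = Poly_Mapping.lookup q e" if "e \<notin> S" for e
    using that by (simp add: S_def in_keys_iff)
  ultimately show ?thesis
    by (intro poly_mapping_eqI) (metis right_minus_eq)
qed

text \<open>The determinant is a Laurent polynomial that agrees with the Weyl quotient wherever the
  denominator is nonzero, so by uniqueness it is the character. The formula then holds at every
  nonzero \<open>t\<close>.\<close>

lemma laurent_eval_weyl_character:
  assumes t: "\<forall>i<N. t i \<noteq> 0"
  shows "laurent_eval (weyl_character N n) t =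
    det (dd_mat N (\<lambda>i. t i + inverse (t i)) (shifted_weight N n))"
proof -
  define k where "k = shifted_weight N n"
  obtain p where p: "laurent_in_vars N p"
      "\<And>t. \<forall>i<N. t i \<noteq> 0 \<Longrightarrow> laurent_eval p t = det (dd_mat N (\<lambda>i. t i + inverse (t i)) k)"
    using is_laurent_det_dd_mat[of N k] unfolding is_laurent_def by blast
  have ev: "laurent_eval p (\<lambda>i. (s i)\<^sup>2) = weyl_alternant N n s / weyl_alternant N (replicate N 0) s"
    if s: "\<forall>i<N. s i \<noteq> 0" "weyl_alternant N (replicate N 0) s \<noteq> 0" for s
  proof -
    define w where "w i = (s i)\<^sup>2 + inverse ((s i)\<^sup>2)" for i
    have "laurent_eval p (\<lambda>i. (s i)\<^sup>2) = det (dd_mat N w k)"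
      unfolding w_def using s(1) by (intro p(2)) auto
    moreover have "weyl_alternant N n s = weyl_alternant N (replicate N 0) s * det (dd_mat N w k)"
      using s(1) weyl_alternant_eq[of N s w n] weyl_alternant_denominator[of N s w]
      by (simp add: w_def k_def)
    ultimately show ?thesis
      using s(2) by simp
  qed
  have "weyl_character N n = p"
    unfolding weyl_character_def
  proof (rule the_equality)
    show "laurent_in_vars N p \<and> (\<forall>s. (\<forall>i<N. s i \<noteq> 0) \<and> weyl_alternant N (replicate N 0) s \<noteq> 0 \<longrightarrow>
        laurent_eval p (\<lambda>i. (s i)\<^sup>2) = weyl_alternant N n s / weyl_alternant N (replicate N 0) s)"
      using p(1) ev by blast
  next
    fix q assume q: "laurent_in_vars N q \<and> (\<forall>s. (\<forall>i<N. s i \<noteq> 0) \<and> weyl_alternant N (replicate N 0) s \<noteq> 0 \<longrightarrow>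
        laurent_eval q (\<lambda>i. (s i)\<^sup>2) = weyl_alternant N n s / weyl_alternant N (replicate N 0) s)"
    show "q = p"
      by (rule laurent_eqI[of N]) (use q p(1) ev in auto)
  qed
  then show ?thesis
    using p(2)[OF t] by (simp add: k_def)
qed

section \<open>Eigenvalues of special orthogonal matrices\<close>

lemma trace_mult_commute:
  fixes A B :: "'a :: comm_ring_1 mat"
  assumes "A \<in> carrier_mat n m" "B \<in> carrier_mat m n"
  shows "trace (A * B) = trace (B * A)"
proof -
  have "trace (A * B) = (\<Sum>i<n. \<Sum>j<m. A $$ (i, j) * B $$ (j, i))"
    using assms by (auto simp: trace_def scalar_prod_def atLeast0LessThan intro!: sum.cong)
  also have "\<dots> = (\<Sum>j<m. \<Sum>i<n. B $$ (j, i) * A $$ (i, j))"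
    by (subst sum.swap) (simp add: mult.commute)
  also have "\<dots> = trace (B * A)"
    using assms by (auto simp: trace_def scalar_prod_def atLeast0LessThan intro!: sum.cong)
  finally show ?thesis .
qed

text \<open>Schur decomposition makes \<open>A\<close> similar to a triangular matrix with diagonal
  \<open>es\<close>, and similarity preserves trace and determinant.\<close>

lemma trace_det_of_char_poly:
  fixes A :: "complex mat"
  assumes A: "A \<in> carrier_mat n n" and cp: "char_poly A = (\<Prod>e\<leftarrow>es. [:- e, 1:])"
  shows "trace A = sum_list es" "det A = prod_list es"
proof -
  obtain B P Q where "schur_decomposition A es = (B, P, Q)"
    by (cases "schur_decomposition A es") auto
  from schur_decomposition[OF A cp this] have
    sim: "similar_mat_wit A B P Q" and ut: "upper_triangular B" and diag: "diag_mat B = es"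
    by auto
  from similar_mat_witD2[OF A sim] have carr: "B \<in> carrier_mat n n" "P \<in> carrier_mat n n" "Q \<in> carrier_mat n n"
    and eq: "A = P * B * Q" "Q * P = 1\<^sub>m n"
    by auto
  have "trace A = trace (Q * (P * B))"
    unfolding eq by (rule trace_mult_commute[of _ n n]) (use carr in auto)
  also have "Q * (P * B) = B"
    using carr eq(2) by (simp flip: assoc_mult_mat)
  also have "trace B = sum_list es"
    using carr(1) unfolding diag[symmetric] trace_def diag_mat_def
    by (simp add: sum_list_distinct_conv_sum_set atLeast0LessThan)
  finally show "trace A = sum_list es" .
  have "det A = det B"
    using sim by (intro det_similar) (auto simp: similar_mat_def)
  then show "det A = prod_list es"
    using det_upper_triangular[OF ut carr(1)] diag by simp
qed

section \<open>Pairing of the eigenvalues\<close>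

lemma inverse_eq_cnj: "cmod a = 1 \<Longrightarrow> inverse a = cnj a"
  by (metis complex_norm_square inverse_unique of_real_1 power_one)

text \<open>Pairs \<open>a, cnj a\<close>, each of product 1, are split off until one element is
  left, which the total product forces to be 1. A nonreal element has its conjugate as partner. If
  all elements are real they are 1 or -1, and two among any three are equal.\<close>

lemma unimodular_multiset_pairing:
  fixes A :: "complex multiset"
  assumes "size A = 2 * N + 1" "image_mset cnj A = A" "\<And>a. a \<in># A \<Longrightarrow> cmod a = 1"
    and "prod_mset A = 1"
  shows "\<exists>t. (\<forall>i<N. cmod (t i) = 1) \<and> A = add_mset 1 (\<Sum>i<N. {#t i, inverse (t i)#})"
  using assms
proof (induction N arbitrary: A)
  case 0
  then obtain a where "A = {#a#}"
    using size_1_singleton_mset[of A] by auto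
  with 0 show ?case by simp
next
  case (Suc N)
  have "\<exists>a A'. A = {#a, cnj a#} + A'"
  proof (cases "\<exists>a\<in>#A. cnj a \<noteq> a")
    case True
    then obtain a where a: "a \<in># A" "cnj a \<noteq> a" by auto
    then have "cnj a \<in># A"
      using Suc.prems(2) by (metis image_eqI set_image_mset)
    then have "{#a, cnj a#} \<subseteq># A"
      using a by (auto simp: insert_subset_eq_iff in_diff_count)
    then show ?thesis
      by (metis subset_mset.le_iff_add)
  next
    case False
    then have real: "cnj a = a" if "a \<in># A" for a using that by auto
    then have pm: "a = 1 \<or> a = -1" if "a \<in># A" for a
      using that Suc.prems(3)[OF that] complex_norm_square[of a] by (simp add: power2_eq_1_iff flip: power2_eq_square)
    obtain a A1 where A1: "A = add_mset a A1" "size A1 = Suc (Suc (2 * N))"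
      using size_eq_Suc_imp_eq_union[of A "Suc (Suc (2 * N))"] Suc.prems(1) by auto
    obtain b A2 where A2: "A1 = add_mset b A2" "size A2 = Suc (2 * N)"
      using size_eq_Suc_imp_eq_union[of A1 "Suc (2 * N)"] A1(2) by auto
    obtain c A' where "A2 = add_mset c A'"
      using size_eq_Suc_imp_eq_union[of A2 "2 * N"] A2(2) by auto
    with A1 A2 have A: "A = {#a, b, c#} + A'" by simp
    then consider "a = b" | "a = c" | "b = c"
      using pm[of a] pm[of b] pm[of c] by auto
    then show ?thesis
    proof cases
      case 1
      then have "A = {#a, cnj a#} + ({#c#} + A')" using A real[of a] by simp
      then show ?thesis by blast
    next
      case 2
      then have "A = {#a, cnj a#} + ({#b#} + A')" using A real[of a] by (simp add: add_mset_commute)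
      then show ?thesis by blast
    next
      case 3
      then have "A = {#b, cnj b#} + ({#a#} + A')" using A real[of b] by (simp add: add_mset_commute)
      then show ?thesis by blast
    qed
  qed
  then obtain a A' where A: "A = {#a, cnj a#} + A'" by blast
  have a: "cmod a = 1" using Suc.prems(3) A by simp
  then have aa: "a * cnj a = 1"
    by (simp flip: complex_norm_square)
  obtain t where t: "\<forall>i<N. cmod (t i) = 1" "A' = add_mset 1 (\<Sum>i<N. {#t i, inverse (t i)#})"
    using Suc.IH[of A'] Suc.prems aa A by (auto simp: add_mset_commute mult.assoc[symmetric])
  have "A = add_mset 1 (\<Sum>i<Suc N. {#(t(N := a)) i, inverse ((t(N := a)) i)#})"
    using A t(2) inverse_eq_cnj[OF a] by (simp add: add_mset_commute)
  moreover have "\<forall>i<Suc N. cmod ((t(N := a)) i) = 1"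
    using a t(1) by (auto simp: less_Suc_eq)
  ultimately show ?case by blast
qed

text \<open>A real orthogonal matrix preserves the Hermitian norm of a complex eigenvector, here
  written as \<open>v \<bullet> w\<close> with \<open>w\<close> the conjugate of
  \<open>v\<close>.\<close>

lemma orthogonal_eigenvalue_norm:
  fixes R :: "real mat"
  assumes R: "R \<in> carrier_mat n n" "transpose_mat R * R = 1\<^sub>m n"
    and a: "eigenvalue (map_mat complex_of_real R) a"
  shows "cmod a = 1"
proof -
  define A where "A = map_mat complex_of_real R"
  have A: "A \<in> carrier_mat n n" using R by (simp add: A_def)
  have AA: "transpose_mat A * A = 1\<^sub>m n"
  proof -
    have "transpose_mat A * A = map_mat complex_of_real (transpose_mat R * R)"
      using R(1) by (simp add: A_def of_real_hom.mat_hom_mult[of "transpose_mat R" n n R n] map_mat_transpose)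
    then show ?thesis by (simp add: R(2) of_real_hom.mat_hom_one)
  qed
  obtain v where v: "v \<in> carrier_vec n" "v \<noteq> 0\<^sub>v n" "A *\<^sub>v v = a \<cdot>\<^sub>v v"
    using a A unfolding eigenvalue_def eigenvector_def A_def by auto
  define w where "w = conjugate v"
  have w: "w \<in> carrier_vec n" using v by (simp add: w_def)
  have Aw: "A *\<^sub>v w = conjugate (A *\<^sub>v v)"
    using R(1) v(1) by (intro eq_vecI) (auto simp: A_def w_def scalar_prod_def)
  have "v \<bullet> w = (transpose_mat A *\<^sub>v (A *\<^sub>v v)) \<bullet> w"
    using A AA v(1) by (simp flip: assoc_mult_mat_vec)
  also have "\<dots> = (A *\<^sub>v v) \<bullet> (A *\<^sub>v w)"
    using A v(1) w by (intro transpose_vec_mult_scalar) auto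
  also have "\<dots> = a * cnj a * (v \<bullet> w)"
    using v(1) w unfolding Aw unfolding v(3) by (simp add: conjugate_smult_vec w_def[symmetric])
  finally have "a * cnj a = 1"
    using v(1,2) conjugate_square_eq_0_vec[of v n] by (simp add: w_def)
  then have "(cmod a)\<^sup>2 = 1"
    by (metis complex_norm_square of_real_eq_1_iff)
  then show ?thesis
    by (simp add: power2_eq_1_iff) (smt (verit) norm_ge_zero)
qed

lemma proots_linear_factors: "proots (\<Prod>a\<leftarrow>as. [:- a, 1:]) = mset (as :: complex list)"
proof (induction as)
  case (Cons a as)
  have "(\<Prod>a\<leftarrow>as. [:- a, 1:]) \<noteq> 0"
    by (auto simp: prod_list_zero_iff)
  then have "proots ([:- a, 1:] * (\<Prod>a\<leftarrow>as. [:- a, 1:])) = proots [:- a, 1:] + proots (\<Prod>a\<leftarrow>as. [:- a, 1:])"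
    by (intro proots_mult) auto
  with Cons show ?case
    by (simp del: mult_pCons_left)
qed simp

lemma prod_mset_sum_pairs:
  fixes f :: "'a \<Rightarrow> 'b :: comm_monoid_mult"
  shows "(\<Prod>a\<in>#(\<Sum>i<N. {#t i, u i#}). f a) = (\<Prod>i<N::nat. f (t i) * f (u i))"
  by (induction N) (auto simp: mult_ac)

text \<open>The spectrum is closed under conjugation since \<open>R\<close> is real, unimodular
  since \<open>R\<close> is orthogonal, and of product 1 since \<open>det R = 1\<close>. This
  justifies the choice in \<open>so_character\<close>.\<close>

lemma eigen_params_exist:
  assumes "R \<in> special_orthogonal (2 * N + 1)"
  shows "\<exists>t. eigen_params N R t"
proof -
  define A where "A = map_mat complex_of_real R"
  have R: "R \<in> carrier_mat (2 * N + 1) (2 * N + 1)" "transpose_mat R * R = 1\<^sub>m (2 * N + 1)" "det R = 1"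
    using assms by (auto simp: special_orthogonal_def)
  have A: "A \<in> carrier_mat (2 * N + 1) (2 * N + 1)" using R by (simp add: A_def)
  obtain as where as: "char_poly A = (\<Prod>a\<leftarrow>as. [:- a, 1:])" "length as = 2 * N + 1"
    using char_poly_factorized[OF A] by blast
  interpret cnj: comm_ring_hom cnj by unfold_locales auto
  interpret cnjp: map_poly_comm_ring_hom cnj ..
  have "map_mat cnj A = A"
    by (intro eq_matI) (auto simp: A_def)
  then have "char_poly A = map_poly cnj (char_poly A)"
    using cnj.char_poly_hom[OF A] by simp
  also have "\<dots> = (\<Prod>a\<leftarrow>map cnj as. [:- a, 1:])"
    by (simp add: as cnjp.hom_prod_list o_def)
  finally have "mset (map cnj as) = mset as"
    using proots_linear_factors as(1) by metis
  moreover have "cmod a = 1" if "a \<in># mset as" for a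
  proof (rule orthogonal_eigenvalue_norm[OF R(1,2)])
    have "poly (char_poly A) a = 0"
      using that by (auto simp: as poly_prod_list prod_list_zero_iff)
    then show "eigenvalue (map_mat complex_of_real R) a"
      using eigenvalue_root_char_poly[OF A] by (simp add: A_def)
  qed
  moreover have "prod_mset (mset as) = 1"
    using trace_det_of_char_poly(2)[OF A as(1)] R(3) by (simp add: A_def prod_mset_prod_list)
  ultimately obtain t where t: "\<forall>i<N. cmod (t i) = 1"
      "mset as = add_mset 1 (\<Sum>i<N. {#t i, inverse (t i)#})"
    using unimodular_multiset_pairing[of "mset as" N] as(2) by auto
  have "char_poly A = (\<Prod>a\<in>#mset as. [:- a, 1:])"
    by (simp add: as flip: prod_mset_prod_list)
  also have "\<dots> = [:- 1, 1:] * (\<Prod>i<N. [:- t i, 1:] * [:- inverse (t i), 1:])"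
    unfolding t(2) image_mset_add_mset prod_mset.add_mset prod_mset_sum_pairs ..
  finally show ?thesis
    using t(1) by (auto simp: eigen_params_def A_def)
qed

lemma trace_eigen_params:
  assumes "R \<in> carrier_mat n n" and "eigen_params N R t"
  shows "complex_of_real (trace R) = 1 + (\<Sum>i<N. t i + inverse (t i))"
proof -
  define es where "es = 1 # map t [0..<N] @ map (\<lambda>i. inverse (t i)) [0..<N]"
  have "char_poly (map_mat complex_of_real R) = (\<Prod>e\<leftarrow>es. [:- e, 1:])"
    using assms(2) unfolding eigen_params_def es_def
    by (simp del: mult_pCons_left mult_pCons_right add: prod.distrib o_def
      prod.distinct_set_conv_list[symmetric] atLeast0LessThan)
  then have "trace (map_mat complex_of_real R) = sum_list es"
    using trace_det_of_char_poly(1)[of "map_mat complex_of_real R" n es] assms(1) by auto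
  also have "\<dots> = 1 + (\<Sum>i<N. t i + inverse (t i))"
    by (simp add: es_def sum.distrib sum_list_distinct_conv_sum_set atLeast0LessThan)
  also have "trace (map_mat complex_of_real R) = complex_of_real (trace R)"
    using assms(1) by (simp add: trace_def)
  finally show ?thesis .
qed

section \<open>The character expansion\<close>

text \<open>A strictly decreasing sequence of naturals drops by at least 1 per step; so subtracting
  the staircase from it leaves a weakly decreasing sequence.\<close>

lemma decreasing_tuples_gap:
  fixes k :: "nat \<Rightarrow> nat"
  assumes k: "k \<in> decreasing_tuples N" and "i \<le> j" "j < N"
  shows "k j + (j - i) \<le> k i"
  using assms(2,3)
proof (induction j rule: dec_induct)
  case (step j)
  have "k (Suc j) < k j"
    using k step.prems by (auto simp: decreasing_tuples_def)
  with step show ?case by auto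
qed simp

text \<open>The matrix is transposed because \<open>cauchy_binet_has_sum\<close> has the summation
  index in the rows of its second factor.\<close>

lemma bessel_det_eq:
  "bessel_det N n (2 * x) = det (mat N N (\<lambda>(i, j). bessel_kernel x (shifted_weight N n i) (N - 1 - j)))"
proof -
  define A where "A = mat N N (\<lambda>(i, j). bessel_kernel x (shifted_weight N n i) (N - 1 - j))"
  have "mat N N (\<lambda>(i, j). bessel_I (int (n ! j) + int (i + 1) - int (j + 1)) (2 * x) -
      bessel_I (int (n ! j) + 2 * int N + 1 - int (i + 1) - int (j + 1)) (2 * x)) = transpose_mat A"
  proof (rule eq_matI)
    fix i j assume "i < dim_row (transpose_mat A)" "j < dim_col (transpose_mat A)"
    then have ij: "i < N" "j < N" by (auto simp: A_def)
    then have arg: "int (n ! j) + int (i + 1) - int (j + 1) = int (shifted_weight N n j) - int (N - 1 - i)"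
      "int (n ! j) + 2 * int N + 1 - int (i + 1) - int (j + 1) = int (shifted_weight N n j) + int (N - 1 - i) + 1"
      by (auto simp: shifted_weight_def)
    show "mat N N (\<lambda>(i, j). bessel_I (int (n ! j) + int (i + 1) - int (j + 1)) (2 * x) -
        bessel_I (int (n ! j) + 2 * int N + 1 - int (i + 1) - int (j + 1)) (2 * x)) $$ (i, j) =
        transpose_mat A $$ (i, j)"
      unfolding index_mat(1)[OF ij] prod.case arg using ij by (simp add: A_def bessel_kernel_def)
  qed (auto simp: A_def)
  then show ?thesis
    unfolding bessel_det_def by (simp add: A_def det_transpose[of _ N])
qed

text \<open>Adding the staircase \<open>N - 1 - j\<close> matches dominant weights with the
  decreasing tuples of the Cauchy-Binet sum.\<close>

lemma bessel_det_schur_has_sum: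
  "((\<lambda>n. bessel_det N n (2 * x) * det (dd_mat N w (shifted_weight N n))) has_sum
    (\<Prod>i<N. exp (x * w i))) (dominant_weights N)"
proof -
  define h where "h k = det (mat N N (\<lambda>(i, j). divided_difference N w (k j) i)) *
    det (mat N N (\<lambda>(i, j). bessel_kernel x (k i) (N - 1 - j)))" for k
  have "(h has_sum det (bessel_dd_mat N x w)) (decreasing_tuples N)"
    unfolding h_def bessel_dd_mat_def
    by (rule cauchy_binet_has_sum) (rule divided_difference_bessel_summable)
  moreover have "((\<lambda>n. bessel_det N n (2 * x) * det (dd_mat N w (shifted_weight N n))) has_sum
      det (bessel_dd_mat N x w)) (dominant_weights N) \<longleftrightarrow>
      (h has_sum det (bessel_dd_mat N x w)) (decreasing_tuples N)"
  proof (rule has_sum_reindex_bij_witness[where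
        i = "\<lambda>k. map (\<lambda>j. k j - (N - 1 - j)) [0..<N]" and
        j = "\<lambda>n. restrict (shifted_weight N n) {0..<N}"])
    fix n assume n: "n \<in> dominant_weights N"
    then have len: "length n = N" and sorted: "\<And>i j. i < j \<Longrightarrow> j < N \<Longrightarrow> n ! j \<le> n ! i"
      by (auto simp: dominant_weights_def sorted_wrt_iff_nth_less)
    show "map (\<lambda>j. restrict (shifted_weight N n) {0..<N} j - (N - 1 - j)) [0..<N] = n"
      by (rule nth_equalityI) (auto simp: len shifted_weight_def)
    have "shifted_weight N n j < shifted_weight N n i" if "i < j" "j < N" for i j
      unfolding shifted_weight_def using sorted[OF that] that by linarith
    then show "restrict (shifted_weight N n) {0..<N} \<in> decreasing_tuples N"
      by (auto simp: decreasing_tuples_def)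
    have "mat N N (\<lambda>(i, j). divided_difference N w (restrict (shifted_weight N n) {0..<N} j) i) =
        dd_mat N w (shifted_weight N n)"
      "mat N N (\<lambda>(i, j). bessel_kernel x (restrict (shifted_weight N n) {0..<N} i) (N - 1 - j)) =
        mat N N (\<lambda>(i, j). bessel_kernel x (shifted_weight N n i) (N - 1 - j))"
      by (auto simp: dd_mat_def)
    then show "h (restrict (shifted_weight N n) {0..<N}) =
        bessel_det N n (2 * x) * det (dd_mat N w (shifted_weight N n))"
      unfolding h_def bessel_det_eq by (simp only: mult.commute)
  next
    fix k :: "nat \<Rightarrow> nat" assume k: "k \<in> decreasing_tuples N"
    define n where "n = map (\<lambda>j. k j - (N - 1 - j)) [0..<N]"
    \<comment> \<open>This makes the truncated subtraction in \<open>n\<close> exact.\<close>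
    have ge: "N - 1 - j \<le> k j" if "j < N" for j
    proof -
      have "k (N - 1) + (N - 1 - j) \<le> k j"
        by (rule decreasing_tuples_gap[OF k]) (use that in auto)
      then show ?thesis by linarith
    qed
    show "restrict (shifted_weight N n) {0..<N} = k"
    proof
      fix j show "restrict (shifted_weight N n) {0..<N} j = k j"
        using ge[of j] k by (cases "j < N")
          (auto simp: n_def shifted_weight_def decreasing_tuples_def PiE_def extensional_def)
    qed
    show "n \<in> dominant_weights N"
    proof -
      have "n ! j \<le> n ! i" if "i < j" "j < N" for i j
        using decreasing_tuples_gap[OF k, of i j] that ge[of i] ge[of j] by (auto simp: n_def)
      then show ?thesis
        by (auto simp: dominant_weights_def sorted_wrt_iff_nth_less) (auto simp: n_def)
    qed
  qed simp
  ultimately show ?thesis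
    by (simp add: det_bessel_dd_mat)
qed

theorem mainTheorem5:
  fixes N :: nat and x :: complex and R :: "real mat"
  assumes "N \<ge> 1"
    and "R \<in> special_orthogonal (2 * N + 1)"
  shows "(\<lambda>n. bessel_det N n (2 * x) * so_character N n R) summable_on dominant_weights N \<and>
    exp (x * complex_of_real (trace R)) =
      exp x * (\<Sum>\<^sub>\<infinity>n\<in>dominant_weights N. bessel_det N n (2 * x) * so_character N n R)"
proof -
  define t where "t = (SOME t. eigen_params N R t)"
  have t: "eigen_params N R t"
    unfolding t_def using eigen_params_exist[OF assms(2)] by (rule someI_ex)
  then have t0: "\<forall>i<N. t i \<noteq> 0"
    by (auto simp: eigen_params_def)
  define w where "w i = t i + inverse (t i)" for i
  have "so_character N n R = det (dd_mat N w (shifted_weight N n))" for n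
    unfolding so_character_def t_def[symmetric] w_def by (rule laurent_eval_weyl_character[OF t0])
  then have "((\<lambda>n. bessel_det N n (2 * x) * so_character N n R) has_sum (\<Prod>i<N. exp (x * w i)))
      (dominant_weights N)"
    using bessel_det_schur_has_sum by simp
  \<comment> \<open>The unpaired eigenvalue 1 accounts for the factor \<open>exp x\<close>.\<close>
  moreover have "complex_of_real (trace R) = 1 + (\<Sum>i<N. w i)"
    using trace_eigen_params[OF _ t, of "2 * N + 1"] assms(2) by (auto simp: special_orthogonal_def w_def)
  then have "exp (x * complex_of_real (trace R)) = exp x * (\<Prod>i<N. exp (x * w i))"
    by (simp add: distrib_left exp_add sum_distrib_left exp_sum)
  ultimately show ?thesis
    by (auto simp: has_sum_iff)
qed

end
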